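(* Every ($P_5$, diamond)-free graph is recolorable.
   Context: Graphs are finite and simple. $P_5$ is the path on 5 vertices; the diamond is $K_4$ minus one edge. A graph is $\mathcal{H}$-free if it has no induced subgraph isomorphic to a member of $\mathcal{H}$. A $k$-coloring of $G$ is a map $V(G)\to\{1,\dots,k\}$ giving adjacent vertices different colors; $\chi(G)$ is the chromatic number. $R_k(G)$ is the graph whose vertices are the $k$-colorings of $G$, two adjacent if they differ on exactly one vertex. $G$ is recolorable if $R_\ell(G)$ is connected for every $\ell\ge\chi(G)+1$. *)

theory Defs
  imports "Graph_Theory.Graph_Theory" "HOL-Library.FuncSet"
begin

text \<open>
  A finite simple graph is a \<^locale>\<open>pair_graph\<close>: a finite vertex set together with a symmetric,
  irreflexive set of ordered pairs of vertices. The null graph is allowed.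
\<close>

definition path5 :: "nat pair_pre_digraph" where
  "path5 = \<lparr> pverts = {..<5}, parcs = {(u, v). u < 5 \<and> v < 5 \<and> (v = Suc u \<or> u = Suc v)} \<rparr>"

definition diamond :: "nat pair_pre_digraph" where
  "diamond = \<lparr> pverts = {..<4},
     parcs = {(u, v). u < 4 \<and> v < 4 \<and> u \<noteq> v} - {(0, 1), (1, 0)} \<rparr>"

definition induced_free :: "'b pair_pre_digraph set \<Rightarrow> 'a pair_pre_digraph \<Rightarrow> bool" where
  "induced_free \<H> G \<longleftrightarrow>
     \<not> (\<exists>F\<in>\<H>. \<exists>H. induced_subgraph H (with_proj G) \<and> digraph_iso H (with_proj F))"

text \<open>
  Colorings are extensional functions (\<^const>\<open>undefined\<close> outside the vertex set), so that two
  colorings are equal as soon as they agree on all vertices.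
\<close>

definition colorings :: "'a pair_pre_digraph \<Rightarrow> nat \<Rightarrow> ('a \<Rightarrow> nat) set" where
  "colorings G k = {f \<in> pverts G \<rightarrow>\<^sub>E {1..k}. \<forall>(u, v)\<in>parcs G. f u \<noteq> f v}"

definition chromatic_number :: "'a pair_pre_digraph \<Rightarrow> nat" where
  "chromatic_number G = (LEAST k. colorings G k \<noteq> {})"

definition reconfiguration_graph :: "'a pair_pre_digraph \<Rightarrow> nat \<Rightarrow> ('a \<Rightarrow> nat) pair_pre_digraph" where
  "reconfiguration_graph G k = \<lparr> pverts = colorings G k,
     parcs = {(f, g). f \<in> colorings G k \<and> g \<in> colorings G k \<and> (\<exists>!v. v \<in> pverts G \<and> f v \<noteq> g v)} \<rparr>"

definition recolorable :: "'a pair_pre_digraph \<Rightarrow> bool" where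
  "recolorable G \<longleftrightarrow>
     (\<forall>l \<ge> chromatic_number G + 1. Digraph_Component.connected (with_proj (reconfiguration_graph G l)))"

lemma pair_graph_path5: "pair_graph path5"
proof -
  have "finite {(u::nat, v::nat). u < 5 \<and> v < 5 \<and> (v = Suc u \<or> u = Suc v)}"
    by (rule finite_subset[of _ "{..<5} \<times> {..<5}"]) auto
  then show ?thesis
    by unfold_locales (auto simp: path5_def symmetric_def sym_def)
qed

lemma pair_graph_diamond: "pair_graph diamond"
proof -
  have "finite ({(u::nat, v::nat). u < 4 \<and> v < 4 \<and> u \<noteq> v} - {(0, 1), (1, 0)})"
    by (rule finite_subset[of _ "{..<4} \<times> {..<4}"]) auto
  then show ?thesis
    by unfold_locales (auto simp: diamond_def symmetric_def sym_def)
qed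

lemma pair_graph_reconfiguration_graph:
  assumes "pair_graph G"
  shows "pair_graph (reconfiguration_graph G k)"
proof -
  interpret pair_graph G by (fact assms)
  have fin: "finite (colorings G k)"
    by (rule finite_subset[of _ "pverts G \<rightarrow>\<^sub>E {1..k}"])
      (auto simp: colorings_def intro!: finite_PiE pair_finite_verts)
  have "finite (parcs (reconfiguration_graph G k))"
    by (rule finite_subset[of _ "colorings G k \<times> colorings G k"])
      (auto simp: reconfiguration_graph_def fin)
  moreover have "sym (parcs (reconfiguration_graph G k))"
    by (rule symI) (simp add: reconfiguration_graph_def eq_commute)
  ultimately show ?thesis
    by unfold_locales (auto simp: fin reconfiguration_graph_def symmetric_def)
qed

lemma chromatic_number_attained:
  assumes "pair_graph G"
  shows "colorings G (chromatic_number G) \<noteq> {}"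
proof -
  interpret pair_graph G by (fact assms)
  have "\<exists>h. bij_betw h (pverts G) {1..card (pverts G)}"
    by (intro finite_same_card_bij pair_finite_verts) simp_all
  then obtain h where h: "bij_betw h (pverts G) {1..card (pverts G)}" ..
  have "restrict h (pverts G) \<in> colorings G (card (pverts G))"
  proof -
    have "u \<in> pverts G \<and> v \<in> pverts G \<and> h u \<noteq> h v" if "(u, v) \<in> parcs G" for u v
      using inj_onD[OF bij_betw_imp_inj_on[OF h], of u v] pair_no_loops[OF that]
        in_arcsD1[OF that] in_arcsD2[OF that] by auto
    then show ?thesis
      using bij_betwE[OF h] by (auto simp: colorings_def)
  qed
  then show ?thesis
    unfolding chromatic_number_def by (intro LeastI[of "\<lambda>k. colorings G k \<noteq> {}"]) auto
qed

lemma induced_free_iff: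
  assumes "pair_graph G" and F: "\<And>F. F \<in> \<H> \<Longrightarrow> pair_graph F"
  shows "induced_free \<H> G \<longleftrightarrow>
    \<not> (\<exists>F\<in>\<H>. \<exists>h. inj_on h (pverts F) \<and> h ` pverts F \<subseteq> pverts G \<and>
         (\<forall>u\<in>pverts F. \<forall>v\<in>pverts F. (h u, h v) \<in> parcs G \<longleftrightarrow> (u, v) \<in> parcs F))"
proof -
  interpret G: pair_graph G by (fact assms)
  have "(\<exists>H. induced_subgraph H (with_proj G) \<and> digraph_iso H (with_proj F)) \<longleftrightarrow>
      (\<exists>h. inj_on h (pverts F) \<and> h ` pverts F \<subseteq> pverts G \<and>
         (\<forall>u\<in>pverts F. \<forall>v\<in>pverts F. (h u, h v) \<in> parcs G \<longleftrightarrow> (u, v) \<in> parcs F))"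
    (is "?L \<longleftrightarrow> ?R") if "F \<in> \<H>" for F
  proof -
    interpret F: pair_graph F using F that by blast
    show ?thesis
    proof
      assume ?L
      then obtain H f where ind: "induced_subgraph H (with_proj G)"
        and iso: "pre_digraph.digraph_isomorphism H f" and app: "with_proj F = app_iso f H"
        by (auto simp: digraph_iso_def)
      have sub: "verts H \<subseteq> pverts G" and th: "tail H = fst" "head H = snd"
        and arcs: "arcs H = {e \<in> parcs G. fst e \<in> verts H \<and> snd e \<in> verts H}"
        using ind by (auto simp: induced_subgraph_def subgraph_def compatible_def)
      have inj: "inj_on (iso_verts f) (verts H)"
        and ends: "\<And>a. a \<in> arcs H \<Longrightarrow> iso_verts f (fst a) = iso_tail f (iso_arcs f a)
                     \<and> iso_verts f (snd a) = iso_head f (iso_arcs f a)"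
        using iso th by (auto simp: pre_digraph.digraph_isomorphism_def)
      have F_eq: "pverts F = iso_verts f ` verts H" "parcs F = iso_arcs f ` arcs H"
        "iso_tail f = fst" "iso_head f = snd"
        using app by (auto simp: with_proj_def app_iso_def)
      have iso_arcs: "iso_arcs f (u, v) = (iso_verts f u, iso_verts f v)" if "(u, v) \<in> arcs H" for u v
        using ends[OF that] F_eq by (simp add: prod_eq_iff)
      have adj: "(iso_verts f u, iso_verts f v) \<in> parcs F \<longleftrightarrow> (u, v) \<in> parcs G"
        if uv: "u \<in> verts H" "v \<in> verts H" for u v
      proof
        assume "(iso_verts f u, iso_verts f v) \<in> parcs F"
        then obtain u' v' where e: "(u', v') \<in> arcs H"
          and "(iso_verts f u, iso_verts f v) = iso_arcs f (u', v')"
          using F_eq by auto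
        then have "iso_verts f u = iso_verts f u'" "iso_verts f v = iso_verts f v'"
          using iso_arcs[OF e] by auto
        moreover have "u' \<in> verts H" "v' \<in> verts H"
          using e arcs by auto
        ultimately have "u = u'" "v = v'"
          using inj uv by (auto dest: inj_onD)
        then show "(u, v) \<in> parcs G"
          using e arcs by auto
      next
        assume "(u, v) \<in> parcs G"
        then have e: "(u, v) \<in> arcs H"
          using arcs uv by auto
        then show "(iso_verts f u, iso_verts f v) \<in> parcs F"
          using iso_arcs[OF e] F_eq by force
      qed
      let ?h = "inv_into (verts H) (iso_verts f)"
      have "inj_on ?h (pverts F)"
        unfolding F_eq by (rule inj_on_inv_into) simp
      moreover have "?h ` pverts F = verts H"
        using inj by (simp add: F_eq inv_into_image_cancel)
      moreover have "\<forall>u\<in>pverts F. \<forall>v\<in>pverts F. (?h u, ?h v) \<in> parcs G \<longleftrightarrow> (u, v) \<in> parcs F"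
        using inj adj by (auto simp: F_eq(1))
      ultimately show ?R
        using sub by blast
    next
      assume ?R
      then obtain h where inj: "inj_on h (pverts F)" and sub: "h ` pverts F \<subseteq> pverts G"
        and adj: "\<And>u v. \<lbrakk>u \<in> pverts F; v \<in> pverts F\<rbrakk> \<Longrightarrow> (h u, h v) \<in> parcs G \<longleftrightarrow> (u, v) \<in> parcs F"
        by blast
      let ?H = "with_proj G \<restriction> (h ` pverts F)"
      have ind: "induced_subgraph ?H (with_proj G)"
        using G.induced_induce sub by simp
      have wf: "wf_digraph ?H"
        using ind by (simp add: induced_subgraph_def subgraph_def)
      let ?g = "inv_into (pverts F) h"
      let ?f = "\<lparr> iso_verts = ?g, iso_arcs = map_prod ?g ?g, iso_head = snd, iso_tail = fst \<rparr>"
      have inj_g: "inj_on ?g (h ` pverts F)"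
        by (rule inj_on_inv_into) simp
      have g_h: "?g (h u) = u" if "u \<in> pverts F" for u
        using inj that by simp
      have "inj_on (map_prod ?g ?g) (arcs ?H)"
        by (rule inj_on_subset[OF map_prod_inj_on[OF inj_g inj_g]]) auto
      then have "pre_digraph.digraph_isomorphism ?H ?f"
        using wf inj_g by (simp add: pre_digraph.digraph_isomorphism_def)
      moreover have "with_proj F = app_iso ?f ?H"
      proof -
        have "pverts F = ?g ` h ` pverts F"
          using inj by simp
        moreover have "parcs F = map_prod ?g ?g ` arcs ?H"
        proof (intro equalityI subrelI)
          fix u v assume e: "(u, v) \<in> parcs F"
          then have uv: "u \<in> pverts F" "v \<in> pverts F"
            by (auto dest: F.in_arcsD1 F.in_arcsD2)
          then have "(h u, h v) \<in> arcs ?H"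
            using adj e by simp
          then have "map_prod ?g ?g (h u, h v) \<in> map_prod ?g ?g ` arcs ?H"
            by (rule imageI)
          then show "(u, v) \<in> map_prod ?g ?g ` arcs ?H"
            using g_h uv by simp
        next
          fix x y assume "(x, y) \<in> map_prod ?g ?g ` arcs ?H"
          then obtain u v where "(u, v) \<in> arcs ?H" and xy: "x = ?g u" "y = ?g v"
            by blast
          then have "(u, v) \<in> parcs G" "u \<in> h ` pverts F" "v \<in> h ` pverts F"
            by auto
          then have "(?g u, ?g v) \<in> parcs F"
            by (subst adj[symmetric]) (simp_all add: f_inv_into_f inv_into_into)
          then show "(x, y) \<in> parcs F"
            by (simp only: xy)
        qed
        ultimately show ?thesis
          by (simp add: with_proj_def app_iso_def induce_subgraph_def)
      qed
      ultimately show ?L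
        using ind unfolding digraph_iso_def by blast
    qed
  qed
  then show ?thesis
    unfolding induced_free_def by (intro arg_cong[of _ _ Not] bex_cong refl)
qed

end

theory Submission
  imports Defs
begin

text \<open>
  Fix \<open>k\<close> with \<open>G\<close> \<open>k\<close>-colorable and consider a minimal induced subgraph on which recoloring with
  \<open>k + 1\<close> colors fails. It has minimum degree at least \<open>k\<close>, since a vertex of smaller degree can
  always step aside, and no vertex has its neighborhood contained in that of a nonadjacent vertex,
  since it could copy the color of that vertex.

  If it is triangle-free, two neighbors of a common vertex yield an induced 5-cycle, and any third
  neighbor of a vertex of a 5-cycle yields nested neighborhoods; so a vertex of the cycle has degree
  2, whereas 5-cycles need three colors. Otherwise let \<open>Q\<close> be a maximum clique. Every other vertex has
  at most one neighbor in \<open>Q\<close>; the sets \<open>N q\<close> of private neighbors are nonempty and independent,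
  and together with \<open>Q\<close> they form a connected component. Excluding induced 5-vertex paths further
  leaves only two cliques joined by a perfect matching, or, when \<open>Q\<close> is a triangle, the circulant
  graph on nine vertices with differences 1 and 3. Both can be recolored, by fixing one suitable
  color class at a time.
\<close>

section \<open>Recoloring\<close>

text \<open>The color set is arbitrary because fixing a color class deletes one color. With total
  functions, one coloring serves for every subset of \<open>S\<close>.\<close>

definition proper_coloring :: "('a \<Rightarrow> 'a \<Rightarrow> bool) \<Rightarrow> 'a set \<Rightarrow> 'c set \<Rightarrow> ('a \<Rightarrow> 'c) \<Rightarrow> bool" where
  "proper_coloring E S C f \<longleftrightarrow> (\<forall>x\<in>S. f x \<in> C) \<and> (\<forall>x\<in>S. \<forall>y\<in>S. E x y \<longrightarrow> f x \<noteq> f y)"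

text \<open>
  Values outside \<open>S\<close> are ignored, so two colorings that agree on \<open>S\<close> are also one step apart.
\<close>

definition recol_step ::
  "('a \<Rightarrow> 'a \<Rightarrow> bool) \<Rightarrow> 'a set \<Rightarrow> 'c set \<Rightarrow> ('a \<Rightarrow> 'c) \<Rightarrow> ('a \<Rightarrow> 'c) \<Rightarrow> bool" where
  "recol_step E S C f g \<longleftrightarrow>
     proper_coloring E S C f \<and> proper_coloring E S C g \<and> (\<exists>v. \<forall>u\<in>S - {v}. f u = g u)"

definition mixing :: "('a \<Rightarrow> 'a \<Rightarrow> bool) \<Rightarrow> 'a set \<Rightarrow> 'c set \<Rightarrow> bool" where
  "mixing E S C \<longleftrightarrow> (\<forall>f g. proper_coloring E S C f \<longrightarrow> proper_coloring E S C g \<longrightarrow>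
     (recol_step E S C)\<^sup>*\<^sup>* f g)"

lemma mixingD:
  "\<lbrakk>mixing E S C; proper_coloring E S C f; proper_coloring E S C g\<rbrakk> \<Longrightarrow> (recol_step E S C)\<^sup>*\<^sup>* f g"
  by (simp add: mixing_def)

lemma proper_coloringD:
  "\<lbrakk>proper_coloring E S C f; x \<in> S; y \<in> S; E x y\<rbrakk> \<Longrightarrow> f x \<noteq> f y"
  by (auto simp: proper_coloring_def)

lemma proper_coloring_cong:
  "(\<And>x. x \<in> S \<Longrightarrow> f x = g x) \<Longrightarrow> proper_coloring E S C f \<longleftrightarrow> proper_coloring E S C g"
  by (simp add: proper_coloring_def)

lemma proper_coloring_subset:
  "proper_coloring E S C f \<Longrightarrow> T \<subseteq> S \<Longrightarrow> proper_coloring E T C f"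
  by (auto simp: proper_coloring_def)

lemma recol_step_agree:
  "proper_coloring E S C f \<Longrightarrow> (\<And>u. u \<in> S - {v} \<Longrightarrow> f u = g u) \<Longrightarrow> proper_coloring E S C g \<Longrightarrow>
    recol_step E S C f g"
  by (auto simp: recol_step_def)

lemma recol_eq_on:
  assumes "proper_coloring E S C f" "\<And>u. u \<in> S \<Longrightarrow> f u = g u"
  shows "recol_step E S C f g"
  using assms proper_coloring_cong[of S f g E C] by (intro recol_step_agree) auto

lemma recol_reach_sym:
  "(recol_step E S C)\<^sup>*\<^sup>* f g \<Longrightarrow> (recol_step E S C)\<^sup>*\<^sup>* g f"
proof (induction rule: rtranclp_induct)
  case (step g k)
  from step.hyps(2) obtain v where "proper_coloring E S C g" "proper_coloring E S C k"
    "\<forall>u\<in>S - {v}. g u = k u" by (auto simp: recol_step_def)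
  then have "recol_step E S C k g" by (intro recol_step_agree[of _ _ _ _ v]) simp_all
  then show ?case using step.IH by (rule converse_rtranclp_into_rtranclp)
qed simp

lemma rtranclp_map:
  assumes "r\<^sup>*\<^sup>* x y" "\<And>a b. r a b \<Longrightarrow> s\<^sup>*\<^sup>* (h a) (h b)"
  shows "s\<^sup>*\<^sup>* (h x) (h y)"
  using assms(1) by (induction rule: rtranclp_induct) (auto intro: assms(2) rtranclp_trans)

lemma mixing_empty: "mixing E {} C"
  by (auto simp: mixing_def intro!: recol_eq_on simp: proper_coloring_def)

lemma obtain_color:
  assumes "finite K" "card K < card C"
  obtains c where "c \<in> C" "c \<notin> K"
  using assms by (meson card_mono leD subsetI)

section \<open>Passing from the mixing of a subgraph to that of the whole graph\<close>

locale simple_adjacency =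
  fixes E :: "'a \<Rightarrow> 'a \<Rightarrow> bool"
  assumes sym: "E x y \<Longrightarrow> E y x" and irrefl: "\<not> E x x"
begin

lemma proper_coloring_update:
  assumes f: "proper_coloring E (S - {v}) C f" and c: "c \<in> C"
    and nb: "\<And>u. u \<in> S \<Longrightarrow> E v u \<Longrightarrow> f u \<noteq> c"
  shows "proper_coloring E S C (f(v := c))"
  unfolding proper_coloring_def
proof (intro conjI ballI impI)
  fix x assume "x \<in> S"
  then show "(f(v := c)) x \<in> C" using f c by (auto simp: proper_coloring_def)
next
  fix x y assume xy: "x \<in> S" "y \<in> S" "E x y"
  then have "x \<noteq> v \<Longrightarrow> y \<noteq> v \<Longrightarrow> f x \<noteq> f y" using f by (auto simp: proper_coloring_def)
  moreover have "x = v \<Longrightarrow> y \<noteq> v \<and> f y \<noteq> c" using nb xy irrefl by auto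
  moreover have "y = v \<Longrightarrow> x \<noteq> v \<and> f x \<noteq> c" using nb xy irrefl sym by auto
  ultimately show "(f(v := c)) x \<noteq> (f(v := c)) y" by (metis fun_upd_apply)
qed

text \<open>Before every step on the rest, \<open>v\<close> moves to a color that is neither present
  on its neighbors nor about to appear on the recolored vertex. This excludes at most degree plus
  one colors.\<close>

lemma lift_recoloring:
  assumes v: "v \<in> S" "finite S" "card {u\<in>S. E v u} + 2 \<le> card C"
    and reach: "(recol_step E (S - {v}) C)\<^sup>*\<^sup>* f g"
    and f': "proper_coloring E S C f'" "\<And>u. u \<in> S - {v} \<Longrightarrow> f' u = f u"
  shows "\<exists>g'. proper_coloring E S C g' \<and> (\<forall>u\<in>S - {v}. g' u = g u) \<and> (recol_step E S C)\<^sup>*\<^sup>* f' g'"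
  using reach
proof (induction rule: rtranclp_induct)
  case base
  then show ?case using f' by blast
next
  case (step g h)
  then obtain g' where g': "proper_coloring E S C g'" "\<forall>u\<in>S - {v}. g' u = g u"
    and reach: "(recol_step E S C)\<^sup>*\<^sup>* f' g'" by blast
  obtain w where w: "\<forall>u\<in>S - {v} - {w}. g u = h u" and h: "proper_coloring E (S - {v}) C h"
    using step.hyps(2) by (auto simp: recol_step_def)
  let ?K = "insert (h w) (g' ` {u\<in>S. E v u})"
  have "card ?K \<le> Suc (card (g' ` {u\<in>S. E v u}))"
    by (simp add: card_insert_le_m1 \<open>finite S\<close> card_insert_if)
  also have "\<dots> \<le> Suc (card {u\<in>S. E v u})"
    by (simp add: card_image_le \<open>finite S\<close>)
  finally have "card ?K < card C" using v by simp
  then obtain c where c: "c \<in> C" "c \<notin> ?K"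
    using obtain_color[of ?K C] \<open>finite S\<close> by auto
  have p1: "proper_coloring E S C (g'(v := c))"
    using c by (intro proper_coloring_update proper_coloring_subset[OF g'(1)]) auto
  have p2: "proper_coloring E S C (h(v := c))"
  proof (intro proper_coloring_update h c(1))
    fix u assume u: "u \<in> S" "E v u"
    then have "u \<in> S - {v}" using irrefl by auto
    then have "u \<noteq> w \<Longrightarrow> h u = g' u" using g'(2) w by auto
    then show "h u \<noteq> c" using c u by blast
  qed
  have "recol_step E S C g' (g'(v := c))"
    using g' p1 by (intro recol_step_agree[of _ _ _ _ v]) auto
  moreover have "recol_step E S C (g'(v := c)) (h(v := c))"
    using p1 p2 g'(2) w by (intro recol_step_agree[of _ _ _ _ w]) auto
  ultimately have "(recol_step E S C)\<^sup>*\<^sup>* f' (h(v := c))"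
    using reach by (meson rtranclp.rtrancl_into_rtrancl)
  moreover have "\<forall>u\<in>S - {v}. (h(v := c)) u = h u" by simp
  ultimately show ?case using p2 by blast
qed

lemma mixing_low_degree:
  assumes v: "v \<in> S" "finite S" "card {u\<in>S. E v u} + 2 \<le> card C"
    and mix: "mixing E (S - {v}) C"
  shows "mixing E S C"
  unfolding mixing_def
proof (intro allI impI)
  fix f g assume f: "proper_coloring E S C f" and g: "proper_coloring E S C g"
  have "(recol_step E (S - {v}) C)\<^sup>*\<^sup>* f g"
    using mix f g by (auto intro!: mixingD proper_coloring_subset[of E S])
  from lift_recoloring[OF v this f] obtain g' where
    g': "proper_coloring E S C g'" "\<forall>u\<in>S - {v}. g' u = g u" "(recol_step E S C)\<^sup>*\<^sup>* f g'" by auto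
  then have "recol_step E S C g' g"
    using g by (intro recol_step_agree[of _ _ _ _ v]) auto
  with g'(3) show "(recol_step E S C)\<^sup>*\<^sup>* f g" by simp
qed

lemma mixing_insert_low_degree:
  assumes "mixing E A C" "finite A" "{u\<in>A. E v u} \<subseteq> K" "finite K" "card K + 2 \<le> card C"
  shows "mixing E (insert v A) C"
proof (cases "v \<in> A")
  case True
  then show ?thesis using assms(1) by (simp add: insert_absorb)
next
  case False
  have "{u\<in>insert v A. E v u} \<subseteq> K" using assms(3) irrefl by blast
  from card_mono[OF assms(4) this] have "card {u\<in>insert v A. E v u} + 2 \<le> card C"
    using assms(5) by linarith
  moreover have "mixing E (insert v A - {v}) C" using assms(1) False by simp
  ultimately show ?thesis using assms(2) mixing_low_degree[of v "insert v A" C] by blast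
qed

text \<open>The vertices of \<open>B\<close> are added one by one; a degree bound in the final graph
  also holds at the time of insertion.\<close>

lemma mixing_Un_low_degree:
  assumes "finite B" "finite A" "mixing E A C"
    and deg: "\<And>v. v \<in> B \<Longrightarrow> card {u\<in>A \<union> B. E v u} + 2 \<le> card C"
  shows "mixing E (A \<union> B) C"
  using \<open>finite B\<close> deg
proof (induction B rule: finite_induct)
  case empty
  then show ?case using assms by simp
next
  case (insert v B)
  have sub: "card {u\<in>A \<union> B. E w u} \<le> card {u\<in>A \<union> insert v B. E w u}" for w
    using \<open>finite A\<close> insert.hyps(1) by (intro card_mono) auto
  have "mixing E (A \<union> B) C"
  proof (rule insert.IH)
    fix w assume "w \<in> B"
    then show "card {u\<in>A \<union> B. E w u} + 2 \<le> card C" using insert.prems[of w] sub[of w] by simp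
  qed
  then have "mixing E (insert v (A \<union> B)) C"
    using insert.prems[of v] sub[of v] \<open>finite A\<close> insert.hyps(1)
    by (intro mixing_insert_low_degree[where K = "{u\<in>A \<union> B. E v u}"]) auto
  then show ?case by simp
qed

text \<open>The vertex \<open>u\<close> can copy the color of \<open>v\<close> throughout any recoloring of the rest.\<close>

lemma mixing_dominated:
  assumes uv: "u \<in> S" "v \<in> S" "u \<noteq> v" "\<not> E u v"
    and dom: "\<And>x. x \<in> S \<Longrightarrow> E u x \<Longrightarrow> E v x"
    and mix: "mixing E (S - {u}) C"
  shows "mixing E S C"
proof -
  let ?c = "\<lambda>f. f(u := f v)"
  have proper: "proper_coloring E S C (?c f)" if "proper_coloring E (S - {u}) C f" for f
  proof (intro proper_coloring_update that)
    show "f v \<in> C" using that uv by (auto simp: proper_coloring_def)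
    fix x assume x: "x \<in> S" "E u x"
    then have "x \<in> S - {u}" "v \<in> S - {u}" "E v x" using uv dom irrefl by auto
    then show "f x \<noteq> f v" using that unfolding proper_coloring_def by metis
  qed
  have step: "(recol_step E S C)\<^sup>*\<^sup>* (?c f) (?c g)" if "recol_step E (S - {u}) C f g" for f g
  proof -
    from that obtain w where f: "proper_coloring E (S - {u}) C f"
      and g: "proper_coloring E (S - {u}) C g" and w: "\<forall>x\<in>S - {u} - {w}. f x = g x"
      by (auto simp: recol_step_def)
    have "f v \<in> C" using f uv by (auto simp: proper_coloring_def)
    \<comment> \<open>Only one vertex changes, so of \<open>v\<close> and a neighbor
      \<open>x\<close> of \<open>u\<close> at least one keeps its color. Hence the old color of
      \<open>v\<close> stays admissible on \<open>u\<close>, which then follows \<open>v\<close> in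
      a second step.\<close>
    have m: "proper_coloring E S C (g(u := f v))"
    proof (intro proper_coloring_update g \<open>f v \<in> C\<close>)
      fix x assume x: "x \<in> S" "E u x"
      then have vx: "E v x" "x \<in> S - {u}" "x \<noteq> v" using dom uv irrefl by auto
      then have "f v \<noteq> f x" "g v \<noteq> g x" using f g uv by (auto simp: proper_coloring_def)
      then show "g x \<noteq> f v" using w vx uv by (cases "x = w") force+
    qed
    have "recol_step E S C (?c f) (g(u := f v))"
      using w m proper[OF f] by (intro recol_step_agree[of _ _ _ _ w]) auto
    moreover have "recol_step E S C (g(u := f v)) (?c g)"
      using m proper[OF g] by (intro recol_step_agree[of _ _ _ _ u]) auto
    ultimately show ?thesis by (meson converse_rtranclp_into_rtranclp r_into_rtranclp)
  qed
  show ?thesis unfolding mixing_def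
  proof (intro allI impI)
    fix f g assume f: "proper_coloring E S C f" and g: "proper_coloring E S C g"
    have p: "proper_coloring E (S - {u}) C f" "proper_coloring E (S - {u}) C g"
      using f g by (auto intro: proper_coloring_subset)
    have "(recol_step E S C)\<^sup>*\<^sup>* (?c f) (?c g)"
      by (rule rtranclp_map[where h = ?c, OF mixingD[OF mix p] step])
    moreover have "recol_step E S C f (?c f)" "recol_step E S C (?c g) g"
      using f g proper p by (auto intro!: recol_step_agree[of _ _ _ _ u] split: if_splits)
    ultimately show "(recol_step E S C)\<^sup>*\<^sup>* f g"
      by (meson converse_rtranclp_into_rtranclp rtranclp.rtrancl_into_rtrancl)
  qed
qed

text \<open>Without edges across, \<open>A\<close> can be recolored while \<open>B\<close> is
  frozen, and then \<open>B\<close>.\<close>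

lemma mixing_Un_disconnected:
  assumes disj: "A \<inter> B = {}" and sep: "\<And>a b. a \<in> A \<Longrightarrow> b \<in> B \<Longrightarrow> \<not> E a b"
    and mix: "mixing E A C" "mixing E B C"
  shows "mixing E (A \<union> B) C"
proof -
  let ?j = "\<lambda>p q x. if x \<in> A then p x else q x"
  have sep': "\<not> E b a" if "a \<in> A" "b \<in> B" for a b using sep sym that by blast
  have proper: "proper_coloring E (A \<union> B) C (?j p q)"
    if "proper_coloring E A C p" "proper_coloring E B C q" for p q
    using that sep sep' disj unfolding proper_coloring_def by auto
  have 1: "(recol_step E (A \<union> B) C)\<^sup>*\<^sup>* (?j p q) (?j p' q)"
    if "recol_step E A C p p'" "proper_coloring E B C q" for p p' q
  proof -
    from that obtain w where p: "proper_coloring E A C p" "proper_coloring E A C p'"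
      and "\<forall>x\<in>A - {w}. p x = p' x" by (auto simp: recol_step_def)
    then have "recol_step E (A \<union> B) C (?j p q) (?j p' q)"
      using proper that by (intro recol_step_agree[of _ _ _ _ w]) auto
    then show ?thesis by simp
  qed
  have 2: "(recol_step E (A \<union> B) C)\<^sup>*\<^sup>* (?j p q) (?j p q')"
    if "recol_step E B C q q'" "proper_coloring E A C p" for p q q'
  proof -
    from that obtain w where q: "proper_coloring E B C q" "proper_coloring E B C q'"
      and "\<forall>x\<in>B - {w}. q x = q' x" by (auto simp: recol_step_def)
    then have "recol_step E (A \<union> B) C (?j p q) (?j p q')"
      using proper that by (intro recol_step_agree[of _ _ _ _ w]) auto
    then show ?thesis by simp
  qed
  show ?thesis unfolding mixing_def
  proof (intro allI impI)
    fix f g assume f: "proper_coloring E (A \<union> B) C f" and g: "proper_coloring E (A \<union> B) C g"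
    have fA: "proper_coloring E A C f" and fB: "proper_coloring E B C f"
      and gA: "proper_coloring E A C g" and gB: "proper_coloring E B C g"
      using f g by (auto intro: proper_coloring_subset)
    have "(recol_step E (A \<union> B) C)\<^sup>*\<^sup>* (?j f f) (?j g f)"
      by (rule rtranclp_map[where h = "\<lambda>p. ?j p f", OF mixingD[OF mix(1) fA gA] 1[OF _ fB]])
    also have "(recol_step E (A \<union> B) C)\<^sup>*\<^sup>* (?j g f) (?j g g)"
      by (rule rtranclp_map[where h = "\<lambda>q. ?j g q", OF mixingD[OF mix(2) fB gB] 2[OF _ gA]])
    finally show "(recol_step E (A \<union> B) C)\<^sup>*\<^sup>* f g" by simp
  qed
qed

text \<open>
  Colorings that all use \<open>c\<close> on a dominating set \<open>A\<close> are colorings of \<open>S - A\<close> with one color less.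
\<close>

lemma recol_fixed_color_class:
  assumes A: "A \<subseteq> S" "\<And>x. x \<in> S - A \<Longrightarrow> \<exists>a\<in>A. E a x"
    and mix: "mixing E (S - A) (C - {c})"
    and f: "proper_coloring E S C f" "\<And>a. a \<in> A \<Longrightarrow> f a = c"
    and g: "proper_coloring E S C g" "\<And>a. a \<in> A \<Longrightarrow> g a = c"
    and "c \<in> C"
  shows "(recol_step E S C)\<^sup>*\<^sup>* f g"
proof -
  let ?j = "\<lambda>p x. if x \<in> A then c else p x"
  have ind: "\<not> E a b" if "a \<in> A" "b \<in> A" for a b
    using f that A(1) unfolding proper_coloring_def by (metis subsetD)
  have rest: "proper_coloring E (S - A) (C - {c}) p"
    if "proper_coloring E S C p" "\<And>a. a \<in> A \<Longrightarrow> p a = c" for p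
    using that A unfolding proper_coloring_def by (metis Diff_iff insert_iff singletonD subsetD)
  have proper: "proper_coloring E S C (?j p)" if "proper_coloring E (S - A) (C - {c}) p" for p
    using that ind \<open>c \<in> C\<close> unfolding proper_coloring_def by auto
  have step: "(recol_step E S C)\<^sup>*\<^sup>* (?j p) (?j q)" if "recol_step E (S - A) (C - {c}) p q" for p q
  proof -
    from that obtain w where pq: "proper_coloring E (S - A) (C - {c}) p"
      "proper_coloring E (S - A) (C - {c}) q" and "\<forall>x\<in>S - A - {w}. p x = q x"
      by (auto simp: recol_step_def)
    then have "recol_step E S C (?j p) (?j q)"
      using proper by (intro recol_step_agree[of _ _ _ _ w]) auto
    then show ?thesis by simp
  qed
  have "(recol_step E S C)\<^sup>*\<^sup>* (?j f) (?j g)"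
    using f g by (intro rtranclp_map[where h = ?j, OF mixingD[OF mix] step] rest) auto
  moreover have "?j f = f" "?j g = g" using f g by auto
  ultimately show ?thesis by simp
qed

lemma greedy_coloring:
  assumes "finite B" "\<And>v. v \<in> B \<Longrightarrow> card {u\<in>B. E v u} < card C"
  shows "\<exists>f. proper_coloring E B C f"
  using assms
proof (induction B rule: finite_induct)
  case empty
  then show ?case by (simp add: proper_coloring_def)
next
  case (insert v B)
  have sub: "card {u\<in>B. E w u} \<le> card {u\<in>insert v B. E w u}" for w
    using insert.hyps(1) by (intro card_mono) auto
  obtain f where f: "proper_coloring E B C f"
    using insert.IH insert.prems sub by (meson insertCI le_less_trans)
  have "card (f ` {u\<in>B. E v u}) \<le> card {u\<in>B. E v u}"
    using insert.hyps(1) by (intro card_image_le) auto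
  also have "\<dots> < card C" using sub[of v] insert.prems[of v] by auto
  finally obtain c where "c \<in> C" "c \<notin> f ` {u\<in>B. E v u}"
    using obtain_color[of "f ` {u\<in>B. E v u}" C] insert.hyps(1) by auto
  then have "proper_coloring E (insert v B) C (f(v := c))"
    using f insert.hyps irrefl by (intro proper_coloring_update) auto
  then show ?case by blast
qed

end

section \<open>Two cliques joined by a perfect matching\<close>

text \<open>The Cartesian product of a complete graph with a single edge; \<open>m\<close> maps each
  vertex to its partner. The number of colors exceeds the chromatic number by one.\<close>

locale matched_cliques = simple_adjacency +
  fixes Q :: "'a set" and m :: "'a \<Rightarrow> 'a" and C :: "'c set"
  assumes finite_Q: "finite Q" and card_Q: "3 \<le> card Q" and card_C: "card C = Suc (card Q)"
    and inj_m: "inj_on m Q" and disj: "m ` Q \<inter> Q = {}"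
    and clique: "\<lbrakk>p \<in> Q; q \<in> Q; p \<noteq> q\<rbrakk> \<Longrightarrow> E p q"
    and clique_m: "\<lbrakk>p \<in> Q; q \<in> Q; p \<noteq> q\<rbrakk> \<Longrightarrow> E (m p) (m q)"
    and matching: "\<lbrakk>p \<in> Q; q \<in> Q\<rbrakk> \<Longrightarrow> E p (m q) \<longleftrightarrow> p = q"
begin

lemma matching_sym: "\<lbrakk>p \<in> Q; q \<in> Q\<rbrakk> \<Longrightarrow> E (m q) p \<longleftrightarrow> p = q"
  using matching sym by blast

lemma finite_C: "finite C"
  using card_C card.infinite by fastforce

lemma card_Q_minus: "K \<subseteq> Q \<Longrightarrow> card (Q - K) = card Q - card K"
  using finite_Q by (meson card_Diff_subset finite_subset)

lemma card_m_image: "card (m ` (Q - K)) = card (Q - K)"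
  by (intro card_image inj_on_subset[OF inj_m]) auto

text \<open>
  With \<open>card Q + 1\<close> colors, both cliques always share a color, necessarily on nonadjacent vertices
  \<open>i\<close> and \<open>m j\<close>. Fixing that color class leaves a graph of low degree.
\<close>

definition crossing :: "'a \<Rightarrow> 'a \<Rightarrow> 'c \<Rightarrow> ('a \<Rightarrow> 'c) \<Rightarrow> bool" where
  "crossing i j c f \<longleftrightarrow> proper_coloring E (Q \<union> m ` Q) C f \<and> f i = c \<and> f (m j) = c"

abbreviation reach :: "('a \<Rightarrow> 'c) \<Rightarrow> ('a \<Rightarrow> 'c) \<Rightarrow> bool" where
  "reach \<equiv> (recol_step E (Q \<union> m ` Q) C)\<^sup>*\<^sup>*"

text \<open>Without the fixed class \<open>card Q\<close> colors remain, so vertices may be added as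
  long as each meets at most \<open>card Q - 2\<close> of those present.\<close>

lemma reach_crossing:
  assumes ij: "i \<in> Q" "j \<in> Q" "i \<noteq> j" and c: "c \<in> C"
    and f: "crossing i j c f" and g: "crossing i j c g"
  shows "reach f g"
proof (rule recol_fixed_color_class[where A = "{i, m j}" and c = c])
  show "{i, m j} \<subseteq> Q \<union> m ` Q" using ij by auto
  show "\<exists>a\<in>{i, m j}. E a x" if "x \<in> Q \<union> m ` Q - {i, m j}" for x
    using that ij clique[of i x] clique_m[of j] by auto
  have card_C': "card (C - {c}) = card Q"
    using c card_C finite_C by simp
  have "mixing E ({} \<union> (Q - {i})) (C - {c})"
  proof (rule mixing_Un_low_degree)
    fix v assume v: "v \<in> Q - {i}"
    have "card {u \<in> {} \<union> (Q - {i}). E v u} \<le> card (Q - {i, v})"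
      using finite_Q irrefl by (intro card_mono) auto
    also have "\<dots> = card Q - 2" using card_Q_minus[of "{i, v}"] ij v by auto
    finally show "card {u \<in> {} \<union> (Q - {i}). E v u} + 2 \<le> card (C - {c})"
      using card_C' card_Q by linarith
  qed (use finite_Q mixing_empty in auto)
  then have "mixing E ((Q - {i}) \<union> m ` (Q - {i, j})) (C - {c})"
  proof (intro mixing_Un_low_degree)
    fix v assume "v \<in> m ` (Q - {i, j})"
    then obtain t where t: "t \<in> Q" "t \<noteq> i" "t \<noteq> j" "v = m t" by auto
    have "card {u \<in> (Q - {i}) \<union> m ` (Q - {i, j}). E v u} \<le> card (insert t (m ` (Q - {i, j, t})))"
      using finite_Q irrefl t matching_sym by (intro card_mono) auto
    also have "\<dots> \<le> Suc (card (m ` (Q - {i, j, t})))"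
      by (simp add: card_insert_if finite_Q)
    also have "\<dots> = Suc (card Q - 3)"
      unfolding card_m_image using card_Q_minus[of "{i, j, t}"] ij t by auto
    finally show "card {u \<in> (Q - {i}) \<union> m ` (Q - {i, j}). E v u} + 2 \<le> card (C - {c})"
      using card_C' card_Q by linarith
  qed (use finite_Q in auto)
  \<comment> \<open>The vertex \<open>m i\<close> comes last: its partner is gone, so it meets only
    \<open>card Q - 2\<close> vertices, whereas its earlier presence would give each of these one
    neighbor too many.\<close>
  then have "mixing E (insert (m i) ((Q - {i}) \<union> m ` (Q - {i, j}))) (C - {c})"
  proof (rule mixing_insert_low_degree)
    show "{u \<in> (Q - {i}) \<union> m ` (Q - {i, j}). E (m i) u} \<subseteq> m ` (Q - {i, j})"
      using ij matching_sym by auto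
    show "card (m ` (Q - {i, j})) + 2 \<le> card (C - {c})"
      unfolding card_m_image using card_Q_minus[of "{i, j}"] ij card_C' card_Q by simp
  qed (use finite_Q in auto)
  moreover have "insert (m i) ((Q - {i}) \<union> m ` (Q - {i, j})) = Q \<union> m ` Q - {i, m j}"
    using ij disj inj_m by (auto dest: inj_onD)
  ultimately show "mixing E (Q \<union> m ` Q - {i, m j}) (C - {c})" by simp
qed (use f g c in \<open>auto simp: crossing_def\<close>)

text \<open>Outside the two classes every vertex has at most \<open>card Q - 3\<close> neighbors in
  its own clique and one partner, fewer than the \<open>card Q - 1\<close> remaining colors, so a
  greedy coloring of the rest exists.\<close>

lemma crossing_pair_exists:
  assumes Q: "i \<in> Q" "j \<in> Q" "k \<in> Q" "l \<in> Q" and ne: "i \<noteq> j" "k \<noteq> l" "i \<noteq> k" "j \<noteq> l"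
    and cd: "c \<in> C" "d \<in> C" "c \<noteq> d"
  shows "\<exists>f. crossing i j c f \<and> crossing k l d f"
proof -
  let ?B = "(Q - {i, k}) \<union> m ` (Q - {j, l})"
  have card_C': "card (C - {c, d}) = card Q - 1"
    using cd card_C finite_C by (simp add: card_Diff_subset)
  have "\<exists>g. proper_coloring E ?B (C - {c, d}) g"
  proof (rule greedy_coloring)
    show "finite ?B" using finite_Q by simp
    fix v assume "v \<in> ?B"
    then consider "v \<in> Q - {i, k}" | t where "t \<in> Q - {j, l}" "v = m t" by auto
    then have "card {u \<in> ?B. E v u} \<le> Suc (card Q - 3)"
    proof cases
      case 1
      have "card {u \<in> ?B. E v u} \<le> card (insert (m v) (Q - {i, k, v}))"
        using finite_Q irrefl 1 matching by (intro card_mono) auto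
      also have "\<dots> \<le> Suc (card (Q - {i, k, v}))" by (simp add: card_insert_if finite_Q)
      also have "\<dots> = Suc (card Q - 3)" using card_Q_minus[of "{i, k, v}"] Q 1 ne by auto
      finally show ?thesis .
    next
      case (2 t)
      have "card {u \<in> ?B. E v u} \<le> card (insert t (m ` (Q - {j, l, t})))"
        using finite_Q irrefl 2 matching_sym by (intro card_mono) auto
      also have "\<dots> \<le> Suc (card (m ` (Q - {j, l, t})))" by (simp add: card_insert_if finite_Q)
      also have "\<dots> = Suc (card Q - 3)"
        unfolding card_m_image using card_Q_minus[of "{j, l, t}"] Q 2 ne by auto
      finally show ?thesis .
    qed
    then show "card {u \<in> ?B. E v u} < card (C - {c, d})" using card_C' card_Q by simp
  qed
  then obtain g where g: "proper_coloring E ?B (C - {c, d}) g" ..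
  have dj: "m x \<noteq> y" "y \<noteq> m x" if "x \<in> Q" "y \<in> Q" for x y using that disj by auto
  have inj: "m x = m y \<longleftrightarrow> x = y" if "x \<in> Q" "y \<in> Q" for x y
    using that inj_m by (auto dest: inj_onD)
  define f where "f = (\<lambda>x. if x \<in> {i, m j} then c else if x \<in> {k, m l} then d else g x)"
  have fc: "x \<in> {i, m j}" if "f x = c" "x \<in> Q \<union> m ` Q" for x
    using that g cd unfolding f_def proper_coloring_def by (auto split: if_splits)
  have fd: "x \<in> {k, m l}" if "f x = d" "x \<in> Q \<union> m ` Q" for x
    using that g cd unfolding f_def proper_coloring_def by (auto split: if_splits)
  have "f i = c" "f (m j) = c" by (simp_all add: f_def)
  moreover have "f k = d" "f (m l) = d" using ne Q dj inj by (simp_all add: f_def)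
  moreover have "proper_coloring E (Q \<union> m ` Q) C f"
    unfolding proper_coloring_def
  proof (intro conjI ballI impI)
    fix x assume "x \<in> Q \<union> m ` Q"
    then show "f x \<in> C" using g cd unfolding f_def proper_coloring_def by auto
  next
    fix x y assume xy: "x \<in> Q \<union> m ` Q" "y \<in> Q \<union> m ` Q" "E x y"
    show "f x \<noteq> f y"
    proof
      assume eq: "f x = f y"
      consider "f x = c" | "f x = d" | "f x \<noteq> c" "f x \<noteq> d" by blast
      then show False
      proof cases
        case 1
        then have "x \<in> {i, m j}" "y \<in> {i, m j}" using fc eq xy by auto
        then show False using xy(3) irrefl matching matching_sym Q ne by auto
      next
        case 2
        then have "x \<in> {k, m l}" "y \<in> {k, m l}" using fd eq xy by auto
        then show False using xy(3) irrefl matching matching_sym Q ne by auto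
      next
        case 3
        then have "x \<in> ?B" "y \<in> ?B" "f x = g x" "f y = g y"
          using xy eq by (auto simp: f_def split: if_splits)
        then show False using g xy(3) eq unfolding proper_coloring_def by metis
      qed
    qed
  qed
  ultimately show ?thesis unfolding crossing_def by blast
qed

text \<open>A coloring that contains both crossing pairs connects the two families.\<close>

lemma crossing_move:
  assumes "i \<in> Q" "j \<in> Q" "k \<in> Q" "l \<in> Q" "i \<noteq> j" "k \<noteq> l" "i \<noteq> k" "j \<noteq> l"
    and "c \<in> C" "d \<in> C" "c \<noteq> d" and f: "crossing i j c f"
  shows "\<exists>g. crossing k l d g \<and> reach f g"
  using crossing_pair_exists[OF assms(1-11)] reach_crossing[OF assms(1,2,5,9) f] by blast

text \<open>The swapped pair \<open>j\<close>, \<open>i\<close> in a third color \<open>e\<close> is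
  compatible with \<open>i\<close>, \<open>j\<close> both in color \<open>c\<close> and in color
  \<open>d\<close>, hence serves as a detour.\<close>

lemma crossing_recolor:
  assumes "i \<in> Q" "j \<in> Q" "i \<noteq> j" "c \<in> C" "d \<in> C" and f: "crossing i j c f"
  shows "\<exists>g. crossing i j d g \<and> reach f g"
proof -
  have "card {c, d} < card C" using card_C card_Q by (auto simp: card_insert_if)
  then obtain e where e: "e \<in> C" "e \<notin> {c, d}" using obtain_color[of "{c, d}" C] by auto
  then obtain g where g: "crossing j i e g" "reach f g"
    using crossing_move[of i j j i c e f] assms by auto
  then obtain h where "crossing i j d h" "reach g h"
    using crossing_move[of j i i j e d g] assms e by auto
  then show ?thesis using g by (meson rtranclp_trans)
qed

lemma crossing_shift:
  assumes "i \<in> Q" "j \<in> Q" "k \<in> Q" "i \<noteq> j" "j \<noteq> k" "c \<in> C" "d \<in> C" and f: "crossing i j c f"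
  shows "\<exists>g. crossing j k d g \<and> reach f g"
proof -
  have "card {c} < card C" using card_C card_Q by auto
  then obtain e where e: "e \<in> C" "e \<notin> {c}" using obtain_color[of "{c}" C] by auto
  then obtain g where g: "crossing j k e g" "reach f g"
    using crossing_move[of i j j k c e f] assms by auto
  then obtain h where "crossing j k d h" "reach g h"
    using crossing_recolor[of j k e d g] assms e by auto
  then show ?thesis using g by (meson rtranclp_trans)
qed

text \<open>Each clique shows \<open>card Q\<close> colors, and two disjoint sets of this size do
  not fit into \<open>Suc (card Q)\<close> colors.\<close>

lemma crossing_exists:
  assumes f: "proper_coloring E (Q \<union> m ` Q) C f"
  shows "\<exists>i\<in>Q. \<exists>j\<in>Q. i \<noteq> j \<and> crossing i j (f i) f"
proof -
  have "f p \<noteq> f q \<and> f (m p) \<noteq> f (m q)" if "p \<in> Q" "q \<in> Q" "p \<noteq> q" for p q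
    using proper_coloringD[OF f] clique clique_m that by simp
  then have "inj_on f Q" "inj_on f (m ` Q)" by (auto simp: inj_on_def)
  then have card: "card (f ` Q) = card Q" "card (f ` m ` Q) = card Q"
    using card_image[OF inj_m] by (simp_all add: card_image)
  have "f ` Q \<union> f ` m ` Q \<subseteq> C" using f by (auto simp: proper_coloring_def)
  then have "card (f ` Q \<union> f ` m ` Q) \<le> Suc (card Q)"
    using card_mono[OF finite_C] card_C by metis
  then have "f ` Q \<inter> f ` m ` Q \<noteq> {}"
    using card card_Un_disjoint[of "f ` Q" "f ` m ` Q"] finite_Q card_Q by auto
  then obtain i j where ij: "i \<in> Q" "j \<in> Q" "f i = f (m j)" by auto
  then have "i \<noteq> j" using f matching unfolding proper_coloring_def by (metis UnI1 UnI2 imageI)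
  then show ?thesis using ij f unfolding crossing_def by metis
qed

lemma mixing_matched_cliques: "mixing E (Q \<union> m ` Q) C"
  unfolding mixing_def
proof (intro allI impI)
  fix f g assume f: "proper_coloring E (Q \<union> m ` Q) C f" and g: "proper_coloring E (Q \<union> m ` Q) C g"
  obtain i j where ij: "i \<in> Q" "j \<in> Q" "i \<noteq> j" "crossing i j (f i) f"
    using crossing_exists[OF f] by blast
  obtain k l where kl: "k \<in> Q" "l \<in> Q" "k \<noteq> l" "crossing k l (g k) g"
    using crossing_exists[OF g] by blast
  have C: "f i \<in> C" "g k \<in> C" using f g ij kl by (auto simp: proper_coloring_def)
  \<comment> \<open>Shift from \<open>i\<close>, \<open>j\<close> over \<open>j\<close>,
    \<open>k\<close> to \<open>k\<close>, \<open>l\<close>; for \<open>k = j\<close> a single shift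
    suffices.\<close>
  have "\<exists>h. crossing k l (g k) h \<and> reach f h"
  proof (cases "k = j")
    case True
    then show ?thesis using crossing_shift[of i j l "f i" "g k" f] ij kl C by blast
  next
    case False
    then obtain h where "crossing j k (g k) h" "reach f h"
      using crossing_shift[of i j k "f i" "g k" f] ij kl C by blast
    moreover from this obtain h' where "crossing k l (g k) h'" "reach h h'"
      using crossing_shift[of j k l "g k" "g k" h] ij kl C False by blast
    ultimately show ?thesis by (meson rtranclp_trans)
  qed
  then show "reach f g"
    using reach_crossing[OF kl(1-3) C(2) _ kl(4)] by (meson rtranclp_trans)
qed

end

section \<open>The circulant graph on nine vertices with differences 1 and 3\<close>

text \<open>All natural numbers serve as indices modulo 9, so a rotation is an addition. Since 8 is
  -1 modulo 9, \<open>i + 8 * j\<close> is the difference of the indices, and 8 and 6 are the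
  negatives of 1 and 3.\<close>

locale circulant9 = simple_adjacency E for E :: "'a \<Rightarrow> 'a \<Rightarrow> bool" +
  fixes h :: "nat \<Rightarrow> 'a"
  assumes h_eq: "h i = h j \<longleftrightarrow> i mod 9 = j mod 9"
    and adj: "E (h i) (h j) \<longleftrightarrow> (i + 8 * j) mod 9 \<in> {1, 3, 6, 8}"
begin

text \<open>Reinterpreting the locale along a rotation carries statements about the triple at 0 over
  to the triple at \<open>t\<close>.\<close>

lemma rotate: "circulant9 E (\<lambda>i. h (i + r))"
proof unfold_locales
  fix i j
  show "h (i + r) = h (j + r) \<longleftrightarrow> i mod 9 = j mod 9"
    unfolding h_eq
  proof
    assume "(i + r) mod 9 = (j + r) mod 9"
    then have "(i + r + 8 * r) mod 9 = (j + r + 8 * r) mod 9" by (rule mod_add_cong) simp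
    moreover have "x + r + 8 * r = x + r * 9" for x by simp
    ultimately show "i mod 9 = j mod 9" by (simp only: mod_mult_self1)
  qed (rule mod_add_cong, simp_all)
  have "(i + r + 8 * (j + r)) = (i + 8 * j) + r * 9" by simp
  then have "(i + r + 8 * (j + r)) mod 9 = (i + 8 * j) mod 9" by (simp only: mod_mult_self1)
  then show "E (h (i + r)) (h (j + r)) \<longleftrightarrow> (i + 8 * j) mod 9 \<in> {1, 3, 6, 8}"
    unfolding adj by simp
qed

lemma range_rotate: "range (\<lambda>i. h (i + r)) = range h"
proof
  have "h i \<in> range (\<lambda>i. h (i + r))" for i
    by (rule image_eqI[of _ _ "i + 8 * r"]) (simp_all add: h_eq)
  then show "range h \<subseteq> range (\<lambda>i. h (i + r))" by auto
qed auto

lemma range_h: "range h = {h 0, h 1, h 2, h 3, h 4, h 5, h 6, h 7, h 8}"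
proof
  have "h i \<in> h ` {..<9}" for i
    by (rule image_eqI[of _ _ "i mod 9"]) (simp_all add: h_eq)
  moreover have "{..<9::nat} = {0, 1, 2, 3, 4, 5, 6, 7, 8}" by auto
  ultimately show "range h \<subseteq> {h 0, h 1, h 2, h 3, h 4, h 5, h 6, h 7, h 8}"
    by auto
qed auto

abbreviation reach :: "'c set \<Rightarrow> ('a \<Rightarrow> 'c) \<Rightarrow> ('a \<Rightarrow> 'c) \<Rightarrow> bool" where
  "reach C \<equiv> (recol_step E (range h) C)\<^sup>*\<^sup>*"

text \<open>
  The independent triples are \<open>{t, t + 2, t + 4}\<close>. They are dominating, and removing one leaves a
  4-cycle with two pendant vertices.
\<close>

definition triple :: "'c set \<Rightarrow> nat \<Rightarrow> 'c \<Rightarrow> ('a \<Rightarrow> 'c) \<Rightarrow> bool" where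
  "triple C t c f \<longleftrightarrow> proper_coloring E (range h) C f \<and>
     f (h t) = c \<and> f (h (t + 2)) = c \<and> f (h (t + 4)) = c"

lemma triple_rotate:
  "circulant9.triple E (\<lambda>i. h (i + r)) C t c f \<longleftrightarrow> triple C (t + r) c f"
  unfolding triple_def circulant9.triple_def[OF rotate] range_rotate by (simp add: add_ac)

lemma mixing_minus_triple:
  assumes "3 \<le> card C"
  shows "mixing E (range h - {h 0, h 2, h 4}) C"
proof -
  have "mixing E {h 6} C"
    by (rule mixing_insert_low_degree[OF mixing_empty, where K = "{}"]) (use assms in auto)
  then have "mixing E {h 7, h 6} C"
    by (rule mixing_insert_low_degree[where K = "{h 6}"]) (use assms in \<open>auto simp: adj\<close>)
  then have "mixing E {h 8, h 7, h 6} C"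
    by (rule mixing_insert_low_degree[where K = "{h 7}"]) (use assms in \<open>auto simp: adj\<close>)
  then have 1: "mixing E ({h 5, h 8, h 7, h 6} - {h 5}) C"
    by (simp add: insert_Diff_if h_eq)
  \<comment> \<open>This closes the 4-cycle. With three colors, degree 2 is too large for insertion
    by degree, but both neighbors of \<open>h 5\<close> are neighbors of \<open>h 7\<close>.\<close>
  have "mixing E {h 5, h 8, h 7, h 6} C"
    by (rule mixing_dominated[of "h 5" _ "h 7", OF _ _ _ _ _ 1]) (auto simp: adj h_eq)
  then have "mixing E {h 3, h 5, h 8, h 7, h 6} C"
    by (rule mixing_insert_low_degree[where K = "{h 6}"]) (use assms in \<open>auto simp: adj\<close>)
  then have "mixing E {h 1, h 3, h 5, h 8, h 7, h 6} C"
    by (rule mixing_insert_low_degree[where K = "{h 7}"]) (use assms in \<open>auto simp: adj\<close>)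
  moreover have "range h - {h 0, h 2, h 4} = {h 1, h 3, h 5, h 8, h 7, h 6}"
    unfolding range_h by (auto simp: h_eq)
  ultimately show ?thesis by simp
qed

lemma reach_triple_0:
  assumes "4 \<le> card C" "c \<in> C" and f: "triple C 0 c f" and g: "triple C 0 c g"
  shows "reach C f g"
proof (rule recol_fixed_color_class[where A = "{h 0, h 2, h 4}" and c = c])
  have "finite C" using assms(1) card.infinite by fastforce
  then show "mixing E (range h - {h 0, h 2, h 4}) (C - {c})"
    using assms by (intro mixing_minus_triple) auto
  show "\<exists>a\<in>{h 0, h 2, h 4}. E a x" if "x \<in> range h - {h 0, h 2, h 4}" for x
    using that unfolding range_h by (auto simp: adj)
qed (use f g assms in \<open>auto simp: triple_def numeral_2_eq_2\<close>)

lemma reach_triple: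
  assumes "4 \<le> card C" "c \<in> C" "triple C t c f" "triple C t c g"
  shows "reach C f g"
  using circulant9.reach_triple_0[OF rotate, of C c t f g] assms
  unfolding triple_rotate range_rotate by simp

text \<open>The triples at 0 and 1 leave the path \<open>h 6\<close>, \<open>h 7\<close>,
  \<open>h 8\<close>, whose ends can share a color, so four colors suffice.\<close>

lemma triple_pair_exists:
  assumes "4 \<le> card C" "c \<in> C" "d \<in> C" "c \<noteq> d"
  shows "\<exists>f. triple C 0 c f \<and> triple C 1 d f"
proof -
  have "card {c, d} < card C" using assms by (auto simp: card_insert_if)
  then obtain a where a: "a \<in> C" "a \<notin> {c, d}" using obtain_color[of "{c, d}" C] by auto
  have "card {a, c, d} < card C" using assms by (auto simp: card_insert_if)
  then obtain b where b: "b \<in> C" "b \<notin> {a, c, d}" using obtain_color[of "{a, c, d}" C] by auto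
  define f where "f = (\<lambda>x. if x \<in> {h 0, h 2, h 4} then c else if x \<in> {h 1, h 3, h 5} then d
    else if x = h 7 then b else a)"
  have val: "f (h 0) = c" "f (h (Suc 0)) = d" "f (h 2) = c" "f (h 3) = d" "f (h 4) = c" "f (h 5) = d"
    "f (h 6) = a" "f (h 7) = b" "f (h 8) = a"
    by (simp_all add: f_def h_eq)
  have "proper_coloring E (range h) C f"
    unfolding proper_coloring_def range_h using a b assms by (auto simp: val adj)
  then show ?thesis using val unfolding triple_def by (intro exI[of _ f]) (simp add: eval_nat_numeral)
qed

lemma triple_pair_exists_shift:
  assumes "4 \<le> card C" "c \<in> C" "d \<in> C" "c \<noteq> d"
  shows "\<exists>f. triple C t c f \<and> triple C (Suc t) d f"
  using circulant9.triple_pair_exists[OF rotate, of C c d t] assms unfolding triple_rotate by simp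

lemma triple_recolor:
  assumes C: "4 \<le> card C" and "c \<in> C" "d \<in> C" and f: "triple C t c f"
  shows "\<exists>g. triple C t d g \<and> reach C f g"
proof -
  have "card {c, d} < card C" using assms by (auto simp: card_insert_if)
  then obtain e where e: "e \<in> C" "e \<notin> {c, d}" using obtain_color[of "{c, d}" C] by auto
  then obtain g where g: "triple C t c g" "triple C (Suc t) e g"
    using triple_pair_exists_shift[of C c e t] assms by auto
  obtain k where k: "triple C t d k" "triple C (Suc t) e k"
    using triple_pair_exists_shift[of C d e t] assms e by auto
  have "reach C f g" "reach C g k"
    using reach_triple[OF C \<open>c \<in> C\<close> f g(1)] reach_triple[OF C e(1) g(2) k(2)] by auto
  then show ?thesis using k by (meson rtranclp_trans)
qed

text \<open>Each advance by one passes through a coloring with two consecutive triples, the new one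
  in an auxiliary color \<open>e\<close>, and then recolors the new triple with
  \<open>d\<close>.\<close>

lemma triple_shift:
  assumes C: "4 \<le> card C" and c: "c \<in> C" and d: "d \<in> C" and f: "triple C t c f"
  shows "\<exists>g. triple C (t + n) d g \<and> reach C f g"
proof (induction n)
  case 0
  then show ?case using triple_recolor[OF assms] by simp
next
  case (Suc n)
  then obtain g where g: "triple C (t + n) d g" "reach C f g" by blast
  have "card {d} < card C" using assms by auto
  then obtain e where e: "e \<in> C" "e \<noteq> d" using obtain_color[of "{d}" C] by auto
  then obtain k where k: "triple C (t + n) d k" "triple C (Suc (t + n)) e k"
    using triple_pair_exists_shift[of C d e "t + n"] C d by auto
  have "reach C g k" using reach_triple[OF C d g(1) k(1)] .
  moreover obtain l where "triple C (Suc (t + n)) d l" "reach C k l"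
    using triple_recolor[OF C e(1) d k(2)] by blast
  ultimately show ?case using g(2) by (metis add_Suc_right rtranclp_trans)
qed

text \<open>Of the neighbors of \<open>h 4\<close>, all but \<open>h 7\<close> are adjacent to
  \<open>h 0\<close> or \<open>h 2\<close>. So \<open>h 4\<close> can take the common color unless
  \<open>h 7\<close> has it, and then \<open>h 7\<close>, \<open>h 0\<close>, \<open>h 2\<close> is
  already a triple.\<close>

lemma reach_triple_from_02:
  assumes f: "proper_coloring E (range h) C f" and eq: "f (h 0) = f (h 2)"
  shows "\<exists>t g. triple C t (f (h 0)) g \<and> reach C f g"
proof (cases "f (h 7) = f (h 0)")
  case True
  have "h 9 = h 0" "h 11 = h 2" by (simp_all add: h_eq)
  then have "triple C 7 (f (h 0)) f" using f eq True by (simp add: triple_def)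
  then show ?thesis by blast
next
  case False
  let ?g = "f(h 4 := f (h 0))"
  have "proper_coloring E (range h) C ?g"
  proof (intro proper_coloring_update proper_coloring_subset[OF f])
    show "f (h 0) \<in> C" using f by (auto simp: proper_coloring_def)
    fix u assume "u \<in> range h" "E (h 4) u"
    then have "u \<in> {h 1, h 3, h 5, h 7}" unfolding range_h by (auto simp: adj)
    moreover have "E (h 0) (h 1)" "E (h 0) (h 3)" "E (h 2) (h 5)"
      by (simp_all add: adj)
    then have "f (h 1) \<noteq> f (h 0)" "f (h 3) \<noteq> f (h 0)" "f (h 5) \<noteq> f (h 2)"
      using proper_coloringD[OF f, symmetric] by auto
    ultimately show "f u \<noteq> f (h 0)" using eq False by auto
  qed auto
  moreover from this have "recol_step E (range h) C f ?g"
    using f by (intro recol_step_agree[of _ _ _ _ "h 4"]) auto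
  ultimately show ?thesis using eq
    by (intro exI[of _ 0] exI[of _ ?g]) (simp add: triple_def h_eq r_into_rtranclp numeral_2_eq_2)
qed

text \<open>Every neighbor of the middle vertex \<open>h 2\<close> is adjacent to \<open>h 0\<close>
  or \<open>h 4\<close>, so \<open>h 2\<close> can take their color at once.\<close>

lemma reach_triple_from_04:
  assumes f: "proper_coloring E (range h) C f" and eq: "f (h 0) = f (h 4)"
  shows "\<exists>t g. triple C t (f (h 0)) g \<and> reach C f g"
proof -
  let ?g = "f(h 2 := f (h 0))"
  have "proper_coloring E (range h) C ?g"
  proof (intro proper_coloring_update proper_coloring_subset[OF f])
    show "f (h 0) \<in> C" using f by (auto simp: proper_coloring_def)
    fix u assume "u \<in> range h" "E (h 2) u"
    then have "u \<in> {h 1, h 3, h 5, h 8}" unfolding range_h by (auto simp: adj)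
    moreover have "E (h 0) (h 1)" "E (h 0) (h 3)" "E (h 4) (h 5)" "E (h 0) (h 8)"
      by (simp_all add: adj)
    then have "f (h 1) \<noteq> f (h 0)" "f (h 3) \<noteq> f (h 0)" "f (h 5) \<noteq> f (h 4)" "f (h 8) \<noteq> f (h 0)"
      using proper_coloringD[OF f, symmetric] by auto
    ultimately show "f u \<noteq> f (h 0)" using eq by auto
  qed auto
  moreover from this have "recol_step E (range h) C f ?g"
    using f by (intro recol_step_agree[of _ _ _ _ "h 2"]) auto
  ultimately show ?thesis using eq
    by (intro exI[of _ 0] exI[of _ ?g]) (simp add: triple_def h_eq r_into_rtranclp numeral_2_eq_2)
qed

lemma reach_triple_from_pair:
  assumes f: "proper_coloring E (range h) C f" and eq: "f (h i) = f (h (i + k))" and k: "k \<in> {2, 4}"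
  shows "\<exists>t c g. c \<in> C \<and> triple C t c g \<and> reach C f g"
proof -
  interpret r: circulant9 E "\<lambda>j. h (j + i)" by (rule rotate)
  have f': "proper_coloring E (range (\<lambda>j. h (j + i))) C f" using f range_rotate by simp
  have "\<exists>t g. r.triple C t (f (h (0 + i))) g \<and> r.reach C f g"
    using k eq r.reach_triple_from_02[OF f'] r.reach_triple_from_04[OF f'] by (auto simp: add.commute)
  moreover have "f (h (0 + i)) \<in> C" using f by (auto simp: proper_coloring_def)
  ultimately show ?thesis unfolding triple_rotate range_rotate by blast
qed

text \<open>By the pigeonhole principle two of the nine vertices share a color. Their indices differ
  by 2, 4, 5 or 7, and 5 and 7 become 4 and 2 when counted the other way around.\<close>

lemma reach_some_triple:
  assumes C: "finite C" "card C \<le> 8" and f: "proper_coloring E (range h) C f"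
  shows "\<exists>t c g. c \<in> C \<and> triple C t c g \<and> reach C f g"
proof -
  have "(\<lambda>i. f (h i)) ` {..<9} \<subseteq> C" using f by (auto simp: proper_coloring_def)
  then have "\<not> inj_on (\<lambda>i. f (h i)) {..<9}"
    using card_inj_on_le[of "\<lambda>i. f (h i)" "{..<9}" C] C by auto
  then obtain i j where ij: "i < 9" "j < 9" "i < j" "f (h i) = f (h j)"
    unfolding inj_on_def by (metis lessThan_iff linorder_neqE_nat)
  have "\<not> E (h i) (h j)" using f ij unfolding proper_coloring_def by blast
  then have "(i + 8 * j) mod 9 \<notin> {1, 3, 6, 8}" by (simp add: adj)
  moreover obtain d where j: "j = i + d" and d: "0 < d" "d < 9"
    using ij by (metis add_diff_inverse_nat less_imp_diff_less not_less_iff_gr_or_eq zero_less_diff)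
  moreover have "(i + 8 * j) mod 9 = (9 - d) mod 9"
  proof -
    have "i + 8 * j = (9 - d) + 9 * (i + d - 1)" using j d by simp
    then show ?thesis by (simp only: mod_mult_self2)
  qed
  moreover have "d \<in> {1, 2, 3, 4, 5, 6, 7, 8}" using d by auto
  ultimately have "d \<in> {2, 4, 5, 7}" by (elim insertE) auto
  then consider "d \<in> {2, 4}" | "d \<in> {5, 7}" by blast
  then show ?thesis
  proof cases
    case 1
    then show ?thesis using reach_triple_from_pair[OF f, of i d] ij(4) j by blast
  next
    case 2
    then have "h (j + (9 - d)) = h i" using j by (auto simp: h_eq)
    then have "f (h j) = f (h (j + (9 - d)))" using ij(4) by simp
    moreover have "9 - d \<in> {2, 4}" using 2 by auto
    ultimately show ?thesis by (rule reach_triple_from_pair[OF f])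
  qed
qed

lemma mixing_circulant9:
  assumes C: "4 \<le> card C" "card C \<le> 8"
  shows "mixing E (range h) C"
  unfolding mixing_def
proof (intro allI impI)
  have fin: "finite C" using C card.infinite by fastforce
  fix f g assume f: "proper_coloring E (range h) C f" and g: "proper_coloring E (range h) C g"
  obtain t c f' where f': "c \<in> C" "triple C t c f'" "reach C f f'"
    using reach_some_triple[OF fin C(2) f] by blast
  obtain s d g' where g': "d \<in> C" "triple C s d g'" "reach C g g'"
    using reach_some_triple[OF fin C(2) g] by blast
  \<comment> \<open>Triples move only forward; \<open>s + 8 * t\<close> is congruent to the
    difference of \<open>s\<close> and \<open>t\<close> modulo 9.\<close>
  obtain k where k: "triple C (t + (s + 8 * t)) d k" "reach C f' k"
    using triple_shift[OF C(1) f'(1) g'(1) f'(2)] by blast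
  have "h (t + (s + 8 * t) + x) = h (s + x)" for x
  proof -
    have "t + (s + 8 * t) + x = s + x + t * 9" by simp
    then show ?thesis unfolding h_eq by (simp only: mod_mult_self1)
  qed
  from this[of 0] this[of 2] this[of 4] have "triple C s d k"
    using k(1) unfolding triple_def by simp
  then have "reach C k g'" using reach_triple[OF C(1) g'(1) _ g'(2)] by blast
  moreover have "reach C g' g" using g'(3) by (rule recol_reach_sym)
  ultimately show "reach C f g" using f'(3) k(2) by (meson rtranclp_trans)
qed

end

section \<open>Irreducible graphs\<close>

text \<open>A chordless walk along four edges has five distinct vertices, so \<open>p5\<close>
  excludes exactly the induced paths. By \<open>diamond\<close>, the common neighbors of an edge
  form a clique.\<close>

locale p5_diamond_free = simple_adjacency +
  assumes p5: "\<lbrakk>E a b; E b c; E c d; E d e\<rbrakk> \<Longrightarrow> E a c \<or> E a d \<or> E a e \<or> E b d \<or> E b e \<or> E c e"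
    and diamond: "\<lbrakk>E u v; E u x; E v x; E u y; E v y\<rbrakk> \<Longrightarrow> x = y \<or> E x y"

text \<open>
  The properties of a minimal induced subgraph on which recoloring with \<open>k + 1\<close> colors fails.
\<close>

locale irreducible = p5_diamond_free E for E :: "'a \<Rightarrow> 'a \<Rightarrow> bool" +
  fixes S :: "'a set" and k :: nat
  assumes fin: "finite S" and nonempty: "S \<noteq> {}"
    and colorable: "\<exists>f. proper_coloring E S {1..k} f"
    and deg: "v \<in> S \<Longrightarrow> k \<le> card {u\<in>S. E v u}"
    and incomparable: "\<lbrakk>u \<in> S; v \<in> S; u \<noteq> v; \<not> E u v\<rbrakk> \<Longrightarrow> \<exists>x\<in>S. E u x \<and> \<not> E v x"
begin

lemma clique_card_le:
  assumes "K \<subseteq> S" "\<And>x y. \<lbrakk>x \<in> K; y \<in> K; x \<noteq> y\<rbrakk> \<Longrightarrow> E x y"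
  shows "card K \<le> k"
proof -
  obtain f where f: "proper_coloring E S {1..k} f" using colorable ..
  have "inj_on f K"
  proof (rule inj_onI, rule ccontr)
    fix x y assume "x \<in> K" "y \<in> K" "f x = f y" "x \<noteq> y"
    then show False using assms proper_coloringD[OF f, of x y] by auto
  qed
  moreover have "f ` K \<subseteq> {1..k}" using f assms(1) by (auto simp: proper_coloring_def)
  ultimately have "card K \<le> card {1..k}" by (intro card_inj_on_le) auto
  then show ?thesis by simp
qed

lemma obtain_neighbor:
  assumes "v \<in> S" "finite K" "card K < k"
  obtains u where "u \<in> S" "E v u" "u \<notin> K"
proof -
  have "\<not> {u\<in>S. E v u} \<subseteq> K"
  proof
    assume "{u\<in>S. E v u} \<subseteq> K"
    from card_mono[OF assms(2) this] show False using deg[OF assms(1)] assms(3) by linarith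
  qed
  then show ?thesis using that by blast
qed

section \<open>Excluding triangle-free irreducible graphs\<close>

lemma false_of_c5_twin:
  assumes triangle_free: "\<not> (\<exists>a\<in>S. \<exists>b\<in>S. \<exists>c\<in>S. E a b \<and> E b c \<and> E a c)"
    and C: "c1 \<in> S" "c2 \<in> S" "c3 \<in> S" "c4 \<in> S" "c5 \<in> S" "E c1 c2" "E c2 c3" "E c3 c4" "E c4 c5" "E c5 c1"
    and a: "a \<in> S" "a \<noteq> c2" "E a c1" "E a c3"
  shows False
proof -
  have tri: False if "a \<in> S" "b \<in> S" "c \<in> S" "E a b" "E b c" "E a c" for a b c
    using triangle_free that by blast
  have no: "\<not> E c1 c3" "\<not> E c1 c4" "\<not> E c2 c4" "\<not> E c2 c5" "\<not> E c3 c5" "\<not> E a c2" "\<not> E a c4" "\<not> E a c5"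
    using tri C a sym by meson+
  \<comment> \<open>The vertex \<open>a\<close> can replace \<open>c2\<close> in the cycle, yet has
    a neighbor \<open>p\<close> that \<open>c2\<close> lacks. Without triangles, \<open>p\<close>
    meets at most one of \<open>c4\<close> and \<open>c5\<close>, and each possibility gives an
    induced path.\<close>
  obtain p where p: "p \<in> S" "E a p" "\<not> E c2 p" using incomparable[of a c2] C a no by blast
  have p13: "\<not> E p c1" "\<not> E p c3" "\<not> (E p c4 \<and> E p c5)" using tri p C a sym by meson+
  consider "\<not> E p c4" "\<not> E p c5" | "E p c4" "\<not> E p c5" | "E p c5" "\<not> E p c4" using p13 by blast
  then show False
  proof cases
    case 1
    then show False using p5[of p a c1 c5 c4] p p13 no C a sym by blast
  next
    case 2
    then show False using p5[of p c4 c5 c1 c2] p p13 no C a sym by blast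
  next
    case 3
    then show False using p5[of p c5 c4 c3 c2] p p13 no C a sym by blast
  qed
qed

text \<open>An odd cycle needs three colors, so \<open>c1\<close> has a third neighbor
  \<open>a\<close>. The path \<open>a c1 c2 c3 c4\<close> must have a chord, and this makes
  \<open>a\<close> a replacement for \<open>c2\<close> or \<open>c5\<close>.\<close>

lemma false_of_c5:
  assumes triangle_free: "\<not> (\<exists>a\<in>S. \<exists>b\<in>S. \<exists>c\<in>S. E a b \<and> E b c \<and> E a c)"
    and C: "c1 \<in> S" "c2 \<in> S" "c3 \<in> S" "c4 \<in> S" "c5 \<in> S" "E c1 c2" "E c2 c3" "E c3 c4" "E c4 c5" "E c5 c1"
  shows False
proof -
  have tri: False if "a \<in> S" "b \<in> S" "c \<in> S" "E a b" "E b c" "E a c" for a b c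
    using triangle_free that by blast
  obtain f where f: "proper_coloring E S {1..k} f" using colorable ..
  have "f x = 1 \<or> f x = 2" if "x \<in> S" "k = 2" for x
    using f that by (fastforce simp: proper_coloring_def)
  moreover have "f c1 \<noteq> f c2" "f c2 \<noteq> f c3" "f c3 \<noteq> f c4" "f c4 \<noteq> f c5" "f c5 \<noteq> f c1"
    using proper_coloringD[OF f] C by auto
  ultimately have "k \<noteq> 2" using C(1-5) by metis
  moreover have "2 \<le> k"
  proof -
    have "card {c1, c2} \<le> k" using C sym by (intro clique_card_le) auto
    then show ?thesis using C irrefl by (cases "c1 = c2") auto
  qed
  moreover have "card {c2, c5} \<le> 2" by (simp add: card_insert_if)
  ultimately have "card {c2, c5} < k" by linarith
  then obtain a where a: "a \<in> S" "E c1 a" "a \<notin> {c2, c5}"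
    using obtain_neighbor[of c1 "{c2, c5}"] C by auto
  have no: "\<not> E c1 c3" "\<not> E c1 c4" "\<not> E c2 c4" "\<not> E a c2"
    using tri C a sym by meson+
  have "E a c3 \<or> E a c4" using p5[of a c1 c2 c3 c4] C a no sym by blast
  then show False
    using false_of_c5_twin[OF triangle_free C, of a]
      false_of_c5_twin[OF triangle_free, of c1 c5 c4 c3 c2 a] C a sym by blast
qed

text \<open>Otherwise two neighbors \<open>s\<close>, \<open>t\<close> of a vertex \<open>v\<close>
  are nonadjacent, and each has a neighbor that the other lacks. The path \<open>a s v t b\<close>
  can only have the chord \<open>a b\<close>, which closes a 5-cycle.\<close>

lemma triangle_exists:
  "\<exists>a\<in>S. \<exists>b\<in>S. \<exists>c\<in>S. E a b \<and> E b c \<and> E a c"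
proof (rule ccontr)
  assume triangle_free: "\<not> ?thesis"
  have tri: False if "a \<in> S" "b \<in> S" "c \<in> S" "E a b" "E b c" "E a c" for a b c
    using triangle_free that by blast
  obtain v where v: "v \<in> S" using nonempty by blast
  have "1 \<le> k" using clique_card_le[of "{v}"] v by simp
  then obtain s where s: "s \<in> S" "E v s" using obtain_neighbor[of v "{}"] v by auto
  then have "s \<noteq> v" using irrefl by blast
  have "card {v, s} \<le> k" using v s sym by (intro clique_card_le) auto
  then have "card {s} < k" using \<open>s \<noteq> v\<close> by simp
  then obtain t where t: "t \<in> S" "E v t" "t \<notin> {s}" using obtain_neighbor[of v "{s}"] v by auto
  have st: "\<not> E s t" using tri[of v s t] v s t by blast
  obtain a where a: "a \<in> S" "E s a" "\<not> E t a" using incomparable[of s t] s t st by auto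
  obtain b where b: "b \<in> S" "E t b" "\<not> E s b" using incomparable[of t s] s t st sym by auto
  have "\<not> E a v" "\<not> E v b" using tri v s t a b sym by meson+
  then have "E a b" using p5[of a s v t b] v s t a b st sym by blast
  then show False using false_of_c5[OF triangle_free, of a s v t b] v s t a b sym by blast
qed

lemma maximum_clique_exists:
  "\<exists>Q\<subseteq>S. (\<forall>x\<in>Q. \<forall>y\<in>Q. x \<noteq> y \<longrightarrow> E x y) \<and> 3 \<le> card Q \<and>
     (\<forall>K\<subseteq>S. (\<forall>x\<in>K. \<forall>y\<in>K. x \<noteq> y \<longrightarrow> E x y) \<longrightarrow> card K \<le> card Q)"
proof -
  let ?P = "\<lambda>K. K \<subseteq> S \<and> (\<forall>x\<in>K. \<forall>y\<in>K. x \<noteq> y \<longrightarrow> E x y)"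
  obtain a b c where abc: "a \<in> S" "b \<in> S" "c \<in> S" "E a b" "E b c" "E a c"
    using triangle_exists by blast
  then have P: "?P {a, b, c}" using sym by auto
  have bound: "\<forall>K. ?P K \<longrightarrow> card K < Suc (card S)"
    using card_mono[OF fin] by (auto simp: less_Suc_eq_le)
  obtain Q where Q: "?P Q" "\<forall>K. ?P K \<longrightarrow> card K \<le> card Q"
    using ex_has_greatest_nat[where P = ?P and f = card, OF P bound] by blast
  have "card {a, b, c} = 3" using abc irrefl by (auto simp: card_insert_if)
  then have "3 \<le> card Q" using Q(2)[rule_format, OF P] by simp
  then show ?thesis using Q by (intro exI[of _ Q]) simp
qed

end

section \<open>Attachment of the other vertices to a maximum clique\<close>

locale irreducible_clique = irreducible E S k for E :: "'a \<Rightarrow> 'a \<Rightarrow> bool" and S k +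
  fixes Q :: "'a set"
  assumes Q: "Q \<subseteq> S" and clique: "\<lbrakk>x \<in> Q; y \<in> Q; x \<noteq> y\<rbrakk> \<Longrightarrow> E x y" and three: "3 \<le> card Q"
    and maximum: "\<lbrakk>K \<subseteq> S; \<And>x y. \<lbrakk>x \<in> K; y \<in> K; x \<noteq> y\<rbrakk> \<Longrightarrow> E x y\<rbrakk> \<Longrightarrow> card K \<le> card Q"
begin

definition N :: "'a \<Rightarrow> 'a set" where
  "N q = {x\<in>S - Q. E q x}"

definition far :: "'a \<Rightarrow> bool" where
  "far z \<longleftrightarrow> z \<in> S - Q \<and> (\<forall>q\<in>Q. \<not> E q z)"

lemma finite_Q: "finite Q"
  using Q fin finite_subset by blast

lemma card_Q_le: "card Q \<le> k"
  using clique_card_le Q clique by blast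

lemma not_in: "finite K \<Longrightarrow> card K < card Q \<Longrightarrow> \<exists>s\<in>Q. s \<notin> K"
  by (meson card_mono leD subsetI)

lemma second: "\<exists>s\<in>Q. s \<noteq> q"
  using not_in[of "{q}"] three by auto

lemma third: "\<exists>s\<in>Q. s \<noteq> q \<and> s \<noteq> r"
  using not_in[of "{q, r}"] three by (auto simp: card_insert_if)

text \<open>With two neighbors in \<open>Q\<close>, diamond-freeness would make \<open>x\<close>
  adjacent to all of \<open>Q\<close>, against maximality.\<close>

lemma attach_unique:
  assumes x: "x \<in> S - Q" and qr: "q \<in> Q" "r \<in> Q" "E q x" "E r x"
  shows "q = r"
proof (rule ccontr)
  assume ne: "q \<noteq> r"
  have all: "E s x" if "s \<in> Q" for s
  proof (cases "s = q \<or> s = r")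
    case True
    then show ?thesis using qr by auto
  next
    case False
    then have "E q s" "E r s" "E q r" using clique qr that ne by auto
    then show ?thesis using diamond[of q r s x] qr that x by auto
  qed
  have "card (insert x Q) \<le> card Q"
    using x Q all clique sym by (intro maximum) auto
  then show False using x finite_Q by simp
qed

lemma N_S: "x \<in> N q \<Longrightarrow> x \<in> S \<and> x \<notin> Q"
  by (simp add: N_def)

lemma N_adj: "x \<in> N q \<Longrightarrow> E q x \<and> E x q"
  by (simp add: N_def sym)

lemma N_nonadj:
  assumes "x \<in> N q" "q \<in> Q" "r \<in> Q" "r \<noteq> q" shows "\<not> E r x \<and> \<not> E x r"
  using attach_unique[of x q r] assms sym by (auto simp: N_def)

lemma N_disjoint: "\<lbrakk>x \<in> N q; x \<in> N r; q \<in> Q; r \<in> Q\<rbrakk> \<Longrightarrow> q = r"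
  using attach_unique by (auto simp: N_def)

lemma far_nonadj: "far z \<Longrightarrow> q \<in> Q \<Longrightarrow> \<not> E q z \<and> \<not> E z q"
  using sym by (auto simp: far_def)

lemma N_nonempty:
  assumes "q \<in> Q" shows "\<exists>x. x \<in> N q"
proof -
  have "card (Q - {q}) < k" using card_Q_le finite_Q assms three by auto
  then obtain u where "u \<in> S" "E q u" "u \<notin> Q - {q}"
    using obtain_neighbor[of q "Q - {q}"] assms Q finite_Q by blast
  then show ?thesis using irrefl unfolding N_def by blast
qed

lemma vertex_cases:
  assumes "x \<in> S" obtains "x \<in> Q" | q where "q \<in> Q" "x \<in> N q" | "far x"
  using assms unfolding N_def far_def by blast

text \<open>If \<open>x'\<close> is adjacent to \<open>y\<close> as well, the edge
  \<open>x x'\<close> has the nonadjacent common neighbors \<open>q\<close> and \<open>y\<close>. If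
  not, \<open>x' x y r s\<close> is an induced path for a third vertex \<open>s\<close> of
  \<open>Q\<close>.\<close>

lemma N_edge_isolated:
  assumes q: "q \<in> Q" "x \<in> N q" "x' \<in> N q" "E x x'" and r: "r \<in> Q" "r \<noteq> q" "y \<in> N r"
  shows "\<not> E x y"
proof
  assume xy: "E x y"
  obtain s where s: "s \<in> Q" "s \<noteq> q" "s \<noteq> r" using third by blast
  note nonadj = N_nonadj[OF q(2,1)] N_nonadj[OF q(3,1)] N_nonadj[OF r(3,1)]
  show False
  proof (cases "E x' y")
    case True
    then show False
      using diamond[of x x' q y] N_adj q xy nonadj r N_S by metis
  next
    case False
    then show False
      using p5[of x' x y r s] q r s xy nonadj N_adj clique sym by metis
  qed
qed

lemma N_independent:
  assumes q: "q \<in> Q" "x \<in> N q" "x' \<in> N q"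
  shows "\<not> E x x'"
proof
  assume e: "E x x'"
  let ?A = "{u\<in>N q. E x u}"
  have finA: "finite ?A" using fin by (simp add: N_def)
  \<comment> \<open>By diamond-freeness \<open>q\<close>, \<open>x\<close> and \<open>?A\<close>
    form a clique. Its size leaves \<open>x\<close> a further neighbor \<open>z\<close>, which turns
    out to be far.\<close>
  have "card (insert q (insert x ?A)) \<le> card Q"
  proof (rule maximum)
    show "insert q (insert x ?A) \<subseteq> S" using q Q by (auto simp: N_def)
    show "E u v" if "u \<in> insert q (insert x ?A)" "v \<in> insert q (insert x ?A)" "u \<noteq> v" for u v
      using that diamond[of q x u v] N_adj q sym by auto
  qed
  moreover have "x \<notin> ?A" "q \<notin> insert x ?A" using irrefl q N_S by auto
  ultimately have "card (insert q ?A) < k" using finA card_Q_le by auto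
  then obtain z where z: "z \<in> S" "E x z" "z \<notin> insert q ?A"
    using obtain_neighbor[of x "insert q ?A"] finA q N_S by auto
  have far: "far z"
  proof (rule vertex_cases[OF z(1)])
    assume "z \<in> Q"
    then show ?thesis using N_nonadj[OF q(2,1)] z by auto
  next
    fix r assume "r \<in> Q" "z \<in> N r"
    then show ?thesis using N_edge_isolated[OF q e, of r z] z by auto
  qed
  note nonadj = N_nonadj[OF q(2,1)] N_nonadj[OF q(3,1)] far_nonadj[OF far]
  have zx': "\<not> E x' z" using diamond[of x x' q z] e z N_adj q nonadj by auto
  obtain r where r: "r \<in> Q" "r \<noteq> q" using second by blast
  obtain y where y: "y \<in> N r" using N_nonempty r by blast
  have xy: "\<not> E x y" "\<not> E x' y"
    using N_edge_isolated[OF q e r y] N_edge_isolated[OF q(1,3,2) _ r y] e sym by auto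
  note nonadj = nonadj N_nonadj[OF y r(1)]
  \<comment> \<open>The path \<open>z x q r y\<close> forces the chord \<open>z y\<close>, and then
    \<open>x' x z y r\<close> is induced.\<close>
  have "E z y" using p5[of z x q r y] z xy nonadj q r y N_adj clique sym by metis
  then show False using p5[of x' x z y r] z xy zx' nonadj q r y e N_adj clique sym by metis
qed

text \<open>Otherwise an induced path starts with \<open>z x\<close> and continues with
  \<open>y r s\<close> if \<open>x\<close> and \<open>y\<close> are adjacent, and with
  \<open>q r y\<close> if not.\<close>

lemma far_complete_other:
  assumes z: "far z" "E z x" and q: "q \<in> Q" "x \<in> N q" and r: "r \<in> Q" "r \<noteq> q" "y \<in> N r"
  shows "E z y"
proof (rule ccontr)
  assume zy: "\<not> E z y"
  obtain s where s: "s \<in> Q" "s \<noteq> q" "s \<noteq> r" using third by blast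
  note nonadj = N_nonadj[OF q(2,1)] N_nonadj[OF r(3,1)] far_nonadj[OF z(1)]
  show False
  proof (cases "E x y")
    case True
    then show False using p5[of z x y r s] z zy q r s nonadj N_adj clique by metis
  next
    case False
    then show False using p5[of z x q r y] z zy q r s nonadj N_adj clique by metis
  qed
qed

lemma far_complete:
  assumes z: "far z" "E z x" and q: "q \<in> Q" "x \<in> N q" and r: "r \<in> Q" "y \<in> N r"
  shows "E z y"
proof (cases "r = q")
  case True
  obtain s where s: "s \<in> Q" "s \<noteq> q" using second by blast
  obtain w where w: "w \<in> N s" using N_nonempty s by blast
  have "E z w" using far_complete_other[OF z q s w] .
  then show ?thesis using far_complete_other[OF z(1) _ s(1) w r(1) _ r(2)] True s by auto
next
  case False
  then show ?thesis using far_complete_other[OF z q r(1) _ r(2)] by auto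
qed

lemma cross_edge_dominates:
  assumes "q \<in> Q" "r \<in> Q" "s \<in> Q" "q \<noteq> r" "q \<noteq> s" "r \<noteq> s"
    and "x \<in> N q" "y \<in> N r" "w \<in> N s" "E x y"
  shows "E x w \<or> E y w"
  using p5[of x y r s w] assms N_nonadj N_adj clique by metis

text \<open>Under \<open>full\<close>, the set \<open>N s\<close> consists of common neighbors of an
  edge between two other sets, so it is a clique; being independent, it is a single vertex. The
  condition \<open>full\<close> will come from a far vertex or from a fourth vertex of
  \<open>Q\<close>.\<close>

lemma matching_of_cross_edge:
  assumes full: "\<And>q r s x y w. \<lbrakk>q \<in> Q; r \<in> Q; s \<in> Q; q \<noteq> r; q \<noteq> s; r \<noteq> s;
      x \<in> N q; y \<in> N r; w \<in> N s; E x y\<rbrakk> \<Longrightarrow> E x w \<and> E y w"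
    and e: "a \<in> Q" "b \<in> Q" "a \<noteq> b" "x \<in> N a" "y \<in> N b" "E x y"
  shows "\<exists>m. (\<forall>q\<in>Q. N q = {m q}) \<and> (\<forall>q\<in>Q. \<forall>r\<in>Q. q \<noteq> r \<longrightarrow> E (m q) (m r))"
proof -
  have single: "w = w'" if "q \<in> Q" "r \<in> Q" "s \<in> Q" "q \<noteq> r" "q \<noteq> s" "r \<noteq> s"
    "u \<in> N q" "v \<in> N r" "E u v" "w \<in> N s" "w' \<in> N s" for q r s u v w w'
    using full[of q r s u v w] full[of q r s u v w'] diamond[of u v w w'] N_independent[of s w w'] that
    by blast
  \<comment> \<open>The given edge and a vertex of a third set form a triangle, and some edge of it
    avoids \<open>N s\<close>.\<close>
  have edge: "\<exists>q\<in>Q. \<exists>r\<in>Q. q \<noteq> r \<and> q \<noteq> s \<and> r \<noteq> s \<and> (\<exists>u\<in>N q. \<exists>v\<in>N r. E u v)" if "s \<in> Q" for s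
  proof -
    obtain t where t: "t \<in> Q" "t \<noteq> a" "t \<noteq> b" using third by blast
    obtain w where w: "w \<in> N t" using N_nonempty t by blast
    then have "E x w" "E y w" using full[of a b t x y w] e t by auto
    then show ?thesis using e t w by metis
  qed
  have uniq: "w = w'" if "s \<in> Q" "w \<in> N s" "w' \<in> N s" for s w w'
    using edge[OF that(1)] single that by metis
  define m where "m q = (SOME x. x \<in> N q)" for q
  have m: "N q = {m q}" if "q \<in> Q" for q
  proof -
    have "m q \<in> N q" unfolding m_def using N_nonempty[OF that] by (rule someI_ex)
    then show ?thesis using uniq[OF that] by blast
  qed
  have xy: "x = m a" "y = m b" using m e by auto
  have mN: "m q \<in> N q" if "q \<in> Q" for q using m that by auto
  have adj: "E x (m q)" "E y (m q)" if "q \<in> Q" "q \<noteq> a" "q \<noteq> b" for q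
    using full[of a b q x y "m q"] e that mN by auto
  have "E (m q) (m r)" if qr: "q \<in> Q" "r \<in> Q" "q \<noteq> r" for q r
  proof (cases "q \<in> {a, b} \<or> r \<in> {a, b}")
    case True
    then show ?thesis using adj e xy qr sym by auto
  next
    case False
    then show ?thesis using full[of a q r x "m q" "m r"] adj e qr mN by auto
  qed
  then show ?thesis using m by blast
qed

text \<open>Such a \<open>z\<close> is complete to all sets \<open>N r\<close>. If there are edges
  between these sets, they form a clique as large as \<open>Q\<close>, which \<open>z\<close>
  enlarges. If there are none, \<open>x\<close> has a second far neighbor \<open>t\<close>, and a
  neighbor of \<open>z\<close> that \<open>t\<close> lacks starts an induced path.\<close>

lemma far_nonadj_N:
  assumes z: "far z" and q: "q \<in> Q" "x \<in> N q"
  shows "\<not> E z x"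
proof
  assume zx: "E z x"
  have complete: "E z y" if "r \<in> Q" "y \<in> N r" for r y using far_complete[OF z zx q that] .
  show False
  proof (cases "\<exists>a\<in>Q. \<exists>b\<in>Q. a \<noteq> b \<and> (\<exists>x\<in>N a. \<exists>y\<in>N b. E x y)")
    case True
    then obtain a b u v where e: "a \<in> Q" "b \<in> Q" "a \<noteq> b" "u \<in> N a" "v \<in> N b" "E u v" by blast
    \<comment> \<open>All three vertices are neighbors of \<open>z\<close>, so one of the two
      adjacencies implies the other by diamond-freeness.\<close>
    have full: "E x w \<and> E y w" if A: "q \<in> Q" "r \<in> Q" "s \<in> Q" "q \<noteq> r" "q \<noteq> s" "r \<noteq> s"
      "x \<in> N q" "y \<in> N r" "w \<in> N s" "E x y" for q r s x y w
    proof -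
      have "y \<noteq> w" "x \<noteq> w" using N_disjoint A by auto
      moreover have "E x z" "E y z" "E z x" "E z y" "E z w" "E y x" using complete A sym by auto
      ultimately show ?thesis
        using cross_edge_dominates[OF A] diamond[of x z y w] diamond[of y z x w] A(10) by blast
    qed
    have "\<exists>m. (\<forall>q\<in>Q. N q = {m q}) \<and> (\<forall>q\<in>Q. \<forall>r\<in>Q. q \<noteq> r \<longrightarrow> E (m q) (m r))"
      by (rule matching_of_cross_edge[OF _ e]) (rule full)
    then obtain m where
      m: "\<forall>q\<in>Q. N q = {m q}" "\<forall>q\<in>Q. \<forall>r\<in>Q. q \<noteq> r \<longrightarrow> E (m q) (m r)" by blast
    have mN: "m q \<in> N q" if "q \<in> Q" for q using m that by auto
    have "inj_on m Q" using mN N_disjoint by (metis inj_onI)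
    then have "card (m ` Q) = card Q" by (rule card_image)
    moreover have "z \<notin> m ` Q" using mN z far_nonadj N_adj by blast
    moreover have "card (insert z (m ` Q)) \<le> card Q"
    proof (rule maximum)
      show "insert z (m ` Q) \<subseteq> S" using mN N_S z by (auto simp: far_def)
      show "E u v" if "u \<in> insert z (m ` Q)" "v \<in> insert z (m ` Q)" "u \<noteq> v" for u v
        using that m(2) complete mN sym by auto
    qed
    ultimately show False using finite_Q by simp
  next
    case False
    have nb: "far u \<or> u = q" if "u \<in> S" "E x u" for u
    proof (rule vertex_cases[OF that(1)])
      assume "u \<in> Q"
      then show ?thesis using N_nonadj[OF q(2,1)] that by auto
    next
      fix r assume r: "r \<in> Q" "u \<in> N r"
      show ?thesis
      proof (cases "r = q")
        case True
        then show ?thesis using N_independent[OF q, of u] r that by simp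
      next
        case neq: False
        then show ?thesis using False q r that by metis
      qed
    qed simp
    have "card {q, z} < k" using card_Q_le three by (auto simp: card_insert_if)
    then obtain t where "t \<in> S" "E x t" "t \<notin> {q, z}"
      using obtain_neighbor[of x "{q, z}"] q N_S by auto
    then have t: "far t" "E x t" "t \<noteq> z" using nb by auto
    obtain r where r: "r \<in> Q" "r \<noteq> q" using second by blast
    obtain y where y: "y \<in> N r" using N_nonempty r by blast
    have "x \<noteq> y" using N_disjoint[of x q r] q r y by auto
    moreover have "\<not> E x y" using False q r y by metis
    ultimately have xy: "\<not> E x y" "x \<noteq> y" by auto
    have complete_t: "E t y" if "r \<in> Q" "y \<in> N r" for r y
      using far_complete[OF t(1) _ q that] t sym by blast
    have "\<not> E z t" using diamond[of z t x y] complete complete_t q r y xy by blast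
    then obtain p where p: "p \<in> S" "E z p" "\<not> E t p"
      using incomparable[of z t] z t by (auto simp: far_def)
    have pfar: "far p"
    proof (rule vertex_cases[OF p(1)])
      assume "p \<in> Q"
      then show ?thesis using far_nonadj[OF z] p by blast
    qed (use complete_t p in auto)
    have "\<not> E p x"
    proof
      assume "E p x"
      then have "E p y" using far_complete[OF pfar _ q r(1) y] by blast
      then show False using diamond[of z p x y] p complete q r y xy \<open>E p x\<close> by blast
    qed
    then show False
      using p5[of p z x q r] p zx q r far_nonadj[OF pfar] far_nonadj[OF z] N_nonadj[OF q(2,1)]
        N_adj clique sym by metis
  qed
qed

end

section \<open>The component of a maximum clique, and maximum cliques with at least four
  vertices\<close>

context irreducible_clique
begin

lemma N_neighbors:
  assumes x: "q \<in> Q" "x \<in> N q" and u: "u \<in> S" "E x u"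
  shows "u = q \<or> (\<exists>r\<in>Q. r \<noteq> q \<and> u \<in> N r)"
proof (rule vertex_cases[OF u(1)])
  assume "u \<in> Q"
  then show ?thesis using N_nonadj[OF x(2,1)] u by auto
next
  fix r assume "r \<in> Q" "u \<in> N r"
  then show ?thesis using N_independent[OF x, of u] u by metis
next
  assume "far u"
  then show ?thesis using far_nonadj_N[OF _ x] u sym by blast
qed

lemma Q_neighbors: "\<lbrakk>q \<in> Q; u \<in> S; E q u\<rbrakk> \<Longrightarrow> u \<in> Q - {q} \<or> u \<in> N q"
  using irrefl unfolding N_def by auto

definition W :: "'a set" where
  "W = Q \<union> (\<Union>q\<in>Q. N q)"

lemma W_closed:
  assumes "u \<in> W" "v \<in> S" "E u v" shows "v \<in> W"
  using assms(1) unfolding W_def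
proof (elim UnE UN_E)
  assume "u \<in> Q"
  then show "v \<in> Q \<union> (\<Union>q\<in>Q. N q)" using Q_neighbors[of u v] assms by auto
next
  fix q assume "q \<in> Q" "u \<in> N q"
  then show "v \<in> Q \<union> (\<Union>q\<in>Q. N q)" using N_neighbors[of q u v] assms by auto
qed

lemma W_subset: "W \<subseteq> S"
  using Q by (auto simp: W_def N_def)

text \<open>A vertex of \<open>Q\<close> has degree at most \<open>card Q\<close>, so the minimum
  degree forces \<open>k = card Q\<close>, as \<open>matched_cliques\<close> requires.\<close>

lemma mixing_of_matching:
  assumes m: "\<And>q. q \<in> Q \<Longrightarrow> N q = {m q}"
    and adj: "\<And>q r. \<lbrakk>q \<in> Q; r \<in> Q; q \<noteq> r\<rbrakk> \<Longrightarrow> E (m q) (m r)"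
    and C: "card C = Suc k"
  shows "mixing E W C"
proof -
  have mN: "m q \<in> N q" if "q \<in> Q" for q using m that by auto
  obtain q where q: "q \<in> Q" using second by blast
  have "{u\<in>S. E q u} \<subseteq> insert (m q) (Q - {q})" using Q_neighbors q m by blast
  then have "card {u\<in>S. E q u} \<le> card (insert (m q) (Q - {q}))"
    using finite_Q by (intro card_mono) auto
  also have "\<dots> \<le> Suc (card (Q - {q}))" by (simp add: card_insert_if finite_Q)
  also have "\<dots> = card Q" using q finite_Q three by simp
  finally have "card Q = k" using deg[of q] Q q card_Q_le by auto
  then have "matched_cliques E Q m C"
  proof unfold_locales
    show "inj_on m Q" using mN N_disjoint by (metis inj_onI)
    show "m ` Q \<inter> Q = {}" using mN N_S by blast
    show "E p (m r) \<longleftrightarrow> p = r" if "p \<in> Q" "r \<in> Q" for p r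
      using N_adj[OF mN] N_nonadj[OF mN] that by blast
  qed (use finite_Q three clique adj C in auto)
  moreover have "W = Q \<union> m ` Q" unfolding W_def using m by auto
  ultimately show ?thesis using matched_cliques.mixing_matched_cliques by metis
qed

text \<open>Otherwise \<open>y x q x' y'\<close> is an induced path. It follows that the
  neighborhoods in \<open>N r\<close> of vertices of \<open>N q\<close> are nested.\<close>

lemma two_nonadjacent_edges:
  assumes q: "q \<in> Q" "x \<in> N q" "x' \<in> N q" and r: "r \<in> Q" "r \<noteq> q" "y \<in> N r" "y' \<in> N r"
    and e: "E x y" "E x' y'" "\<not> E x y'"
  shows "E x' y"
proof (rule ccontr)
  assume "\<not> E x' y"
  then show False
    using p5[of y x q x' y'] q r e N_adj N_nonadj N_independent sym by metis
qed

lemma mixing_of_large_clique: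
  assumes four: "4 \<le> card Q" and C: "card C = Suc k"
  shows "mixing E W C"
proof -
  \<comment> \<open>A fourth vertex \<open>p\<close> of \<open>Q\<close> would otherwise give the
    induced path \<open>p s w x v\<close>.\<close>
  have nb: "E w v" if "q \<in> Q" "s \<in> Q" "t \<in> Q" "q \<noteq> s" "q \<noteq> t" "s \<noteq> t"
    "x \<in> N q" "w \<in> N s" "v \<in> N t" "E x w" "E x v" for q s t x w v
  proof (rule ccontr)
    assume wv: "\<not> E w v"
    have "card {q, s, t} < card Q" using four by (auto simp: card_insert_if)
    then obtain p where p: "p \<in> Q" "p \<noteq> q" "p \<noteq> s" "p \<noteq> t" using not_in[of "{q, s, t}"] by auto
    have "E p s" "E s w" "E w x" using p that clique N_adj sym by auto
    moreover have "\<not> E p w" "\<not> E p x" "\<not> E p v" "\<not> E s x" "\<not> E s v"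
      using that p N_nonadj by auto
    ultimately show False using p5[of p s w x v] that wv by blast
  qed
  have full: "E x w \<and> E y w" if A: "q \<in> Q" "r \<in> Q" "s \<in> Q" "q \<noteq> r" "q \<noteq> s" "r \<noteq> s"
      "x \<in> N q" "y \<in> N r" "w \<in> N s" "E x y" for q r s x y w
    using cross_edge_dominates[OF A]
  proof
    assume "E x w"
    then show ?thesis using nb[of q r s x y w] A by auto
  next
    assume "E y w"
    then show ?thesis using nb[of r q s y x w] A sym by auto
  qed
  obtain q where q: "q \<in> Q" using second by blast
  obtain x where x: "x \<in> N q" using N_nonempty q by blast
  have "card {q} < k" using card_Q_le three by simp
  then obtain u where u: "u \<in> S" "E x u" "u \<noteq> q"
    using obtain_neighbor[of x "{q}"] x N_S by auto
  then obtain r where r: "r \<in> Q" "r \<noteq> q" "u \<in> N r" using N_neighbors[OF q x] by blast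
  have "\<exists>m. (\<forall>q\<in>Q. N q = {m q}) \<and> (\<forall>q\<in>Q. \<forall>r\<in>Q. q \<noteq> r \<longrightarrow> E (m q) (m r))"
    by (rule matching_of_cross_edge[OF _ q r(1) r(2)[symmetric] x r(3) u(2)]) (rule full)
  then show ?thesis using mixing_of_matching C by blast
qed

end

section \<open>Maximum cliques with three vertices\<close>

locale irreducible_triangle = irreducible_clique E S k Q for E :: "'a \<Rightarrow> 'a \<Rightarrow> bool" and S k Q +
  fixes q r s :: 'a
  assumes Q_eq: "Q = {q, r, s}" and distinct: "q \<noteq> r" "q \<noteq> s" "r \<noteq> s"
begin

lemma in_Q: "q \<in> Q" "r \<in> Q" "s \<in> Q"
  by (simp_all add: Q_eq)

lemma Q_iff: "p \<in> Q \<longleftrightarrow> p = q \<or> p = r \<or> p = s"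
  by (simp add: Q_eq)

lemma neighbors: "\<lbrakk>x \<in> N q; u \<in> S; E x u\<rbrakk> \<Longrightarrow> u = q \<or> u \<in> N r \<or> u \<in> N s"
  using N_neighbors[OF in_Q(1)] unfolding Q_eq by auto

text \<open>Otherwise \<open>x\<close> has two neighbors \<open>v\<close>, \<open>v'\<close> in
  \<open>N s\<close>, both complete to \<open>N r\<close>. The neighbors that tell them apart then
  lie in \<open>N q\<close>, where neighborhoods are nested.\<close>

lemma neighbor_in_r:
  assumes x: "x \<in> N q" shows "\<exists>y\<in>N r. E x y"
proof (rule ccontr)
  assume none: "\<not> ?thesis"
  interpret s: irreducible_triangle E S k Q s q r
    using Q_eq distinct by unfold_locales auto
  have "card {q} < k" using card_Q_le three by simp
  then obtain v where v: "v \<in> S" "E x v" "v \<notin> {q}" using obtain_neighbor[of x "{q}"] x N_S by auto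
  have "card {q, v} < k" using card_Q_le three by (auto simp: card_insert_if)
  then obtain v' where v': "v' \<in> S" "E x v'" "v' \<notin> {q, v}"
    using obtain_neighbor[of x "{q, v}"] x N_S by auto
  have vs: "v \<in> N s" "v' \<in> N s" using neighbors[OF x] v v' none by auto
  have complete: "E v y" "E v' y" if "y \<in> N r" for y
    using cross_edge_dominates[of q s r x v y] cross_edge_dominates[of q s r x v' y]
      in_Q distinct x vs v v' that none by auto
  have nvv: "\<not> E v v'" "\<not> E v' v" using N_independent in_Q vs by auto
  obtain a where a: "a \<in> S" "E v a" "\<not> E v' a" using incomparable[of v v'] v v' nvv by auto
  obtain b where b: "b \<in> S" "E v' b" "\<not> E v b" using incomparable[of v' v] v v' nvv by auto
  have "a \<in> N q" using s.neighbors[OF vs(1) a(1,2)] a complete N_adj vs by auto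
  moreover have "b \<in> N q" using s.neighbors[OF vs(2) b(1,2)] b complete N_adj vs by auto
  ultimately show False
    using two_nonadjacent_edges[of s v v' q a b] in_Q distinct vs a b by auto
qed

text \<open>
  By the absence of two nonadjacent edges between \<open>N q\<close> and \<open>N r\<close> this is strict inclusion of neighborhoods in \<open>N r\<close>.
\<close>

definition below :: "'a \<Rightarrow> 'a \<Rightarrow> bool" where
  "below x x' \<longleftrightarrow> (\<exists>y\<in>N r. E x' y \<and> \<not> E x y)"

lemma below_mono:
  assumes x: "x \<in> N q" "x' \<in> N q" "below x x'" and u: "u \<in> N r" "E x u"
  shows "E x' u"
proof -
  obtain y where "y \<in> N r" "E x' y" "\<not> E x y" using x by (auto simp: below_def)
  then show ?thesis using two_nonadjacent_edges[of q x x' r u y] in_Q distinct x u by auto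
qed

text \<open>In \<open>N r\<close> every neighbor of \<open>x\<close> is one of \<open>x'\<close>, so
  incomparability must show in \<open>N s\<close>, where the inclusion is reversed.\<close>

lemma below_witness:
  assumes x: "x \<in> N q" "x' \<in> N q" "below x x'"
  obtains w where "w \<in> N s" "E x w" "\<not> E x' w"
proof -
  have "\<not> E x x'" using N_independent in_Q x by blast
  moreover have "x \<noteq> x'" using x by (auto simp: below_def)
  ultimately obtain w where w: "w \<in> S" "E x w" "\<not> E x' w"
    using incomparable[of x x'] x N_S by auto
  then have "w \<in> N s" using neighbors[OF x(1) w(1,2)] below_mono[OF x] N_adj x by auto
  then show ?thesis using that w by blast
qed

lemma below_cross:
  assumes x: "x \<in> N q" "x' \<in> N q" and w: "w \<in> N s" "\<not> E x' w" and u: "u \<in> N r" "E x' u"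
  shows "E u w"
  using cross_edge_dominates[of q r s x' u w] in_Q distinct x w u by auto

text \<open>The witness \<open>w\<close> is adjacent to every neighbor of \<open>x'\<close> in
  \<open>N r\<close>. So \<open>u\<close> and \<open>u'\<close> are common neighbors of the edge
  \<open>x w\<close>, and they are not adjacent.\<close>

lemma below_unique:
  assumes x: "x \<in> N q" "x' \<in> N q" "below x x'" and u: "u \<in> N r" "E x u" "u' \<in> N r" "E x u'"
  shows "u = u'"
proof -
  obtain w where w: "w \<in> N s" "E x w" "\<not> E x' w" using below_witness[OF x] .
  have "E u w" "E u' w" using below_cross[OF x(1,2) w(1,3)] below_mono[OF x] u by auto
  then show ?thesis
    using diamond[of x w u u'] w u sym N_independent[OF in_Q(2) u(1,3)] by blast
qed

text \<open>If both fail, the neighborhoods in \<open>N r\<close> agree, and each of the two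
  vertices has a neighbor in \<open>N s\<close> that the other lacks, against nestedness.\<close>

lemma below_total:
  assumes x: "x \<in> N q" "x' \<in> N q" "x \<noteq> x'"
  shows "below x x' \<or> below x' x"
proof (rule ccontr)
  assume neg: "\<not> ?thesis"
  have nadj: "\<not> E x x'" "\<not> E x' x" using N_independent in_Q x by auto
  obtain a where a: "a \<in> S" "E x a" "\<not> E x' a" using incomparable[of x x'] x nadj N_S by auto
  obtain b where b: "b \<in> S" "E x' b" "\<not> E x b" using incomparable[of x' x] x nadj N_S by auto
  have "a \<in> N s" using neighbors[OF x(1) a(1,2)] a neg N_adj x by (auto simp: below_def)
  moreover have "b \<in> N s" using neighbors[OF x(2) b(1,2)] b neg N_adj x by (auto simp: below_def)
  ultimately show False
    using two_nonadjacent_edges[of q x x' s a b] in_Q distinct x a b by auto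
qed

text \<open>Being above \<open>x\<close>, the vertex \<open>x'\<close> has two neighbors in
  \<open>N r\<close>, one shared with \<open>x\<close> and one that \<open>x\<close> lacks; being
  below \<open>x''\<close>, it has only one.\<close>

lemma no_below_chain:
  assumes "x \<in> N q" "x' \<in> N q" "x'' \<in> N q" "below x x'" "below x' x''" shows False
proof -
  obtain y where y: "y \<in> N r" "E x' y" "\<not> E x y" using assms by (auto simp: below_def)
  obtain u where u: "u \<in> N r" "E x u" using neighbor_in_r assms by blast
  have "E x' u" using below_mono assms u by blast
  then have "u = y" using below_unique assms y u by blast
  then show False using u y by blast
qed

text \<open>A total relation on three vertices always contains two consecutive arcs, which
  \<open>no_below_chain\<close> excludes.\<close>

lemma N_card_le_2:
  assumes "x \<in> N q" "x' \<in> N q" "x'' \<in> N q" "x \<noteq> x'"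
  shows "x'' \<in> {x, x'}"
proof (rule ccontr)
  assume "\<not> ?thesis"
  then have ne: "x \<noteq> x''" "x' \<noteq> x''" by auto
  have no_chain: "\<not> (below a b \<and> below b c)"
    if "a \<in> {x, x', x''}" "b \<in> {x, x', x''}" "c \<in> {x, x', x''}" for a b c
    using no_below_chain[of a b c] that assms by auto
  have "below x x' \<or> below x' x" "below x x'' \<or> below x'' x" "below x' x'' \<or> below x'' x'"
    using below_total[of x x'] below_total[of x x''] below_total[of x' x''] assms ne by simp_all
  then show False
    using no_chain[of x x' x''] no_chain[of x x'' x'] no_chain[of x' x x''] no_chain[of x' x'' x]
      no_chain[of x'' x x'] no_chain[of x'' x' x] by auto
qed

text \<open>One comparable pair gives all three sets exactly two elements and determines every
  adjacency. The resulting graph is 4-regular, so \<open>k\<close> is at most 4 and the number of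
  colors is within the range treated for \<open>circulant9\<close>.\<close>

lemma mixing_of_below_pair:
  assumes x: "x \<in> N q" "x' \<in> N q" "below x x'" and C: "card C = Suc k"
  shows "mixing E W C"
proof -
  interpret r: irreducible_triangle E S k Q r q s
    using Q_eq distinct by unfold_locales auto
  interpret s: irreducible_triangle E S k Q s q r
    using Q_eq distinct by unfold_locales auto
  interpret q': irreducible_triangle E S k Q q s r
    using Q_eq distinct by unfold_locales auto
  obtain y where y: "y \<in> N r" "E x' y" "\<not> E x y" using x by (auto simp: below_def)
  obtain w where w: "w \<in> N s" "E x w" "\<not> E x' w" using below_witness[OF x] .
  obtain u where u: "u \<in> N r" "E x u" using neighbor_in_r x by blast
  obtain v where v: "v \<in> N s" "E x' v" using q'.neighbor_in_r x by blast
  have x'u: "E x' u" using below_mono[OF x u] .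
  have xv: "E x v"
    using two_nonadjacent_edges[of q x' x s v w] in_Q distinct x v w by auto
  have cross: "E y w" "E u w" using below_cross[OF x(1,2) w(1,3)] y u x'u by auto
  have vy: "E v y" using cross_edge_dominates[of q s r x v y] in_Q distinct x v xv y by auto
  have xx: "\<not> E x x'" "x \<noteq> x'" using N_independent in_Q x by (auto simp: below_def)
  have uv: "\<not> E u v" using diamond[of u v x x'] xx u x'u xv v sym by blast
  have uy: "u \<noteq> y" "v \<noteq> w" using u y v w by auto
  have "N q \<subseteq> {x, x'}" using N_card_le_2[OF x(1,2) _ xx(2)] by blast
  moreover have "N r \<subseteq> {u, y}" using r.N_card_le_2[OF u(1) y(1) _ uy(1)] by blast
  moreover have "N s \<subseteq> {v, w}" using s.N_card_le_2[OF v(1) w(1) _ uy(2)] by blast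
  ultimately have N: "N q = {x, x'}" "N r = {u, y}" "N s = {v, w}"
    using x u y v w by auto
  have indep: "\<not> E x x'" "\<not> E u y" "\<not> E v w"
    using N_independent in_Q x u y v w by auto
  note pos = x'u xv cross vy u(2) v(2) y(2) w(2) clique[OF in_Q(1,2) distinct(1)]
    clique[OF in_Q(1,3) distinct(2)] clique[OF in_Q(2,3) distinct(3)]
    N_adj[OF x(1), THEN conjunct1] N_adj[OF x(2), THEN conjunct1]
    N_adj[OF u(1), THEN conjunct1] N_adj[OF y(1), THEN conjunct1]
    N_adj[OF v(1), THEN conjunct1] N_adj[OF w(1), THEN conjunct1]
  have cross_nonadj: "\<not> E r x" "\<not> E s x" "\<not> E r x'" "\<not> E s x'" "\<not> E q u" "\<not> E s u"
    "\<not> E q y" "\<not> E s y" "\<not> E q v" "\<not> E r v" "\<not> E q w" "\<not> E r w"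
    using N_nonadj in_Q distinct x u y v w by auto
  have neg_sym: "\<not> E b a" if "\<not> E a b" for a b using that sym by blast
  note neg = uv y(3) w(3) indep cross_nonadj
  \<comment> \<open>Besides three disjoint triangles, the edges form the 9-cycle listed here.\<close>
  let ?l = "[q, x, v, s, w, y, r, u, x']"
  let ?h = "\<lambda>i. ?l ! (i mod 9)"
  have dist: "distinct ?l"
  proof -
    have "{x, x', u, y, v, w} \<inter> {q, r, s} = {}" using N_S in_Q x u y v w by auto
    moreover have "{x, x'} \<inter> {u, y} = {}" "{x, x'} \<inter> {v, w} = {}" "{u, y} \<inter> {v, w} = {}"
      using N_disjoint in_Q distinct unfolding N[symmetric] by (metis disjoint_iff)+
    ultimately show ?thesis using distinct xx uy by auto
  qed
  have nine: "i mod 9 \<in> {0, 1, 2, 3, 4, 5, 6, 7, 8}" for i :: nat by auto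
  \<comment> \<open>All 81 index pairs are decided by the lists \<open>pos\<close> and
    \<open>neg\<close>.\<close>
  have adj: "E (?l ! a) (?l ! b) \<longleftrightarrow> (a + 8 * b) mod 9 \<in> {1, 3, 6, 8}"
    if "a \<in> {0, 1, 2, 3, 4, 5, 6, 7, 8}" "b \<in> {0, 1, 2, 3, 4, 5, 6, 7, 8}" for a b
    using that
    by (elim insertE emptyE; simp add: pos pos[THEN sym] neg neg[THEN neg_sym] irrefl)
  have "circulant9 E ?h"
  proof unfold_locales
    fix i j :: nat
    show "?h i = ?h j \<longleftrightarrow> i mod 9 = j mod 9"
      using nth_eq_iff_index_eq[OF dist, of "i mod 9" "j mod 9"] by simp
    have "(i + 8 * j) mod 9 = (i mod 9 + 8 * (j mod 9)) mod 9"
      by (intro mod_add_cong) (simp_all add: mod_mult_right_eq)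
    then show "E (?h i) (?h j) \<longleftrightarrow> (i + 8 * j) mod 9 \<in> {1, 3, 6, 8}"
      using adj[OF nine[of i] nine[of j]] by (simp only:)
  qed
  then interpret c: circulant9 E ?h .
  have "{u\<in>S. E q u} \<subseteq> {r, s, x, x'}" using Q_neighbors[OF in_Q(1)] N(1) Q_iff by auto
  then have "card {u\<in>S. E q u} \<le> card {r, s, x, x'}" by (intro card_mono) auto
  also have "\<dots> \<le> 4" by (auto simp: card_insert_if)
  finally have "k \<le> 4" using deg[of q] in_Q Q by auto
  then have "mixing E (range ?h) C"
    using c.mixing_circulant9[of C] C three card_Q_le by simp
  moreover have "range ?h = W"
    unfolding c.range_h W_def by (auto simp: N Q_iff)
  ultimately show ?thesis by simp
qed

end

context irreducible_clique
begin

lemma mixing_of_triangle: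
  assumes "card Q = 3" and C: "card C = Suc k"
  shows "mixing E W C"
proof (cases "\<exists>q\<in>Q. \<exists>x\<in>N q. \<exists>x'\<in>N q. x \<noteq> x'")
  case True
  then obtain q x x' where q: "q \<in> Q" and x: "x \<in> N q" "x' \<in> N q" "x \<noteq> x'" by blast
  have "card (Q - {q}) = 2" using assms q finite_Q by simp
  then obtain r s where rs: "Q - {q} = {r, s}" "r \<noteq> s" by (auto simp: card_2_iff)
  then interpret irreducible_triangle E S k Q q r s
    using q by unfold_locales auto
  show ?thesis using below_total[OF x] mixing_of_below_pair x C by blast
next
  case False
  define m where "m q = (SOME x. x \<in> N q)" for q
  have m: "N q = {m q}" if "q \<in> Q" for q
  proof -
    have "m q \<in> N q" unfolding m_def using N_nonempty[OF that] by (rule someI_ex)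
    then show ?thesis using False that by blast
  qed
  \<comment> \<open>The only possible neighbors of \<open>m q\<close> are \<open>q\<close> and the
    two other singletons; its degree is at least 3, so it meets both.\<close>
  have "E (m q) (m r)" if q: "q \<in> Q" and r: "r \<in> Q" "q \<noteq> r" for q r
  proof -
    have "card (Q - {q, r}) = 1" using assms q r finite_Q by (simp add: card_Diff_subset)
    then obtain s where s: "Q - {q, r} = {s}" by (auto simp: card_1_singleton_iff)
    have "m q \<in> N q" using m q by blast
    moreover have "card {q, m s} < k" using card_Q_le assms by (auto simp: card_insert_if)
    ultimately obtain u where u: "u \<in> S" "E (m q) u" "u \<notin> {q, m s}"
      using obtain_neighbor[of "m q" "{q, m s}"] N_S by auto
    then obtain t where "t \<in> Q" "t \<noteq> q" "u \<in> N t" using N_neighbors[OF q \<open>m q \<in> N q\<close>] by blast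
    then have "t = r \<or> t = s" "u = m t" using s m by auto
    then have "u = m r" using u by auto
    then show ?thesis using u by simp
  qed
  then show ?thesis using mixing_of_matching m C by blast
qed

lemma mixing_W: "card C = Suc k \<Longrightarrow> mixing E W C"
  using mixing_of_triangle mixing_of_large_clique three by (cases "card Q = 3") auto

end

section \<open>Induction over induced subgraphs\<close>

lemma (in irreducible) mixing_component:
  "\<exists>W\<subseteq>S. W \<noteq> {} \<and> (\<forall>u\<in>W. \<forall>v\<in>S - W. \<not> E u v) \<and>
     (\<forall>C::nat set. card C = Suc k \<longrightarrow> mixing E W C)"
proof -
  obtain Q where Q: "Q \<subseteq> S" "\<forall>x\<in>Q. \<forall>y\<in>Q. x \<noteq> y \<longrightarrow> E x y" "3 \<le> card Q"
    "\<forall>K\<subseteq>S. (\<forall>x\<in>K. \<forall>y\<in>K. x \<noteq> y \<longrightarrow> E x y) \<longrightarrow> card K \<le> card Q"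
    using maximum_clique_exists by metis
  interpret irreducible_clique E S k Q using Q by unfold_locales auto
  have "W \<noteq> {}" using three unfolding W_def by auto
  moreover have "\<forall>u\<in>W. \<forall>v\<in>S - W. \<not> E u v" using W_closed by blast
  moreover have "\<forall>C::nat set. card C = Suc k \<longrightarrow> mixing E W C" by (simp add: mixing_W)
  ultimately show ?thesis using W_subset by (intro exI[of _ W]) simp
qed

text \<open>Colorability with a fixed \<open>k\<close> passes to subgraphs, whereas the chromatic
  number may drop; so the induction is on \<open>S\<close> with \<open>k\<close> fixed.\<close>

lemma (in p5_diamond_free) mixing_of_colorable:
  assumes "finite S" "\<exists>f. proper_coloring E S {1..k} f"
  shows "mixing E S {1..Suc k}"
  using assms
proof (induction S rule: finite_psubset_induct)
  case (psubset S)
  have IH: "mixing E T {1..Suc k}" if "T \<subset> S" for T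
  proof (rule psubset.IH[OF that])
    obtain f where "proper_coloring E S {1..k} f" using psubset.prems ..
    then have "proper_coloring E T {1..k} f" using that by (auto intro: proper_coloring_subset)
    then show "\<exists>f. proper_coloring E T {1..k} f" by blast
  qed
  show ?case
  proof (cases "S = {} \<or> (\<exists>v\<in>S. card {u\<in>S. E v u} < k) \<or>
      (\<exists>u\<in>S. \<exists>v\<in>S. u \<noteq> v \<and> \<not> E u v \<and> (\<forall>x\<in>S. E u x \<longrightarrow> E v x))")
    case False
    then interpret irreducible E S k
      using psubset.hyps psubset.prems
      by (unfold_locales; simp add: not_less) blast
    obtain W where W: "W \<subseteq> S" "W \<noteq> {}" "\<forall>u\<in>W. \<forall>v\<in>S - W. \<not> E u v"
      and mix: "\<forall>C::nat set. card C = Suc k \<longrightarrow> mixing E W C"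
      using mixing_component by blast
    have "mixing E (S - W) {1..Suc k}" using W by (intro IH) auto
    then have "mixing E (W \<union> (S - W)) {1..Suc k}"
      using W mix by (intro mixing_Un_disconnected) auto
    moreover have "W \<union> (S - W) = S" using W by auto
    ultimately show ?thesis by simp
  next
    case True
    then consider "S = {}" | v where "v \<in> S" "card {u\<in>S. E v u} < k"
      | u v where "u \<in> S" "v \<in> S" "u \<noteq> v" "\<not> E u v" "\<forall>x\<in>S. E u x \<longrightarrow> E v x"
      by blast
    then show ?thesis
    proof cases
      case 1
      then show ?thesis by (simp add: mixing_empty)
    next
      case (2 v)
      then have "mixing E (S - {v}) {1..Suc k}" by (intro IH) auto
      moreover have "card {u\<in>S. E v u} + 2 \<le> card {1..Suc k}" using 2 by simp
      ultimately show ?thesis using mixing_low_degree 2(1) psubset.hyps(1) by blast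
    next
      case (3 u v)
      then have "mixing E (S - {u}) {1..Suc k}" by (intro IH) auto
      then show ?thesis using 3 mixing_dominated[of u S v] by blast
    qed
  qed
qed

section \<open>Finite graphs and their reconfiguration graphs\<close>

text \<open>After restriction to the vertices, a step is either an equality or an arc of the
  reconfiguration graph.\<close>

lemma rtranclp_recol_step_imp_reachable:
  assumes "pair_graph G" and reach: "(recol_step (\<lambda>u v. (u, v) \<in> parcs G) (pverts G) {1..l})\<^sup>*\<^sup>* f g"
    and f: "proper_coloring (\<lambda>u v. (u, v) \<in> parcs G) (pverts G) {1..l} f"
  shows "restrict f (pverts G) \<rightarrow>\<^sup>*\<^bsub>with_proj (reconfiguration_graph G l)\<^esub> restrict g (pverts G)"
proof -
  let ?R = "reconfiguration_graph G l" and ?E = "\<lambda>u v. (u, v) \<in> parcs G"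
  interpret G: pair_graph G by (fact assms)
  interpret R: pair_graph ?R by (rule pair_graph_reconfiguration_graph[OF assms(1)])
  have col: "restrict h (pverts G) \<in> pverts ?R" if "proper_coloring ?E (pverts G) {1..l} h" for h
    using that G.in_arcsD1 G.in_arcsD2
    by (auto simp: proper_coloring_def reconfiguration_graph_def colorings_def)
  from reach show ?thesis
  proof (induction rule: rtranclp_induct)
    case base
    show ?case
      by (rule R.reachable_refl) (simp only: with_proj_simps col[OF f])
  next
    case (step h h')
    let ?h = "restrict h (pverts G)" and ?h' = "restrict h' (pverts G)"
    from step.hyps(2) obtain v where h: "proper_coloring ?E (pverts G) {1..l} h"
      "proper_coloring ?E (pverts G) {1..l} h'" and v: "\<And>u. u \<in> pverts G - {v} \<Longrightarrow> h u = h' u"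
      by (auto simp: recol_step_def)
    show ?case
    proof (cases "?h = ?h'")
      case True
      then show ?thesis using step.IH by simp
    next
      case False
      then obtain u where u: "u \<in> pverts G" "h u \<noteq> h' u" by (auto simp: restrict_def fun_eq_iff split: if_splits)
      have "\<exists>!u. u \<in> pverts G \<and> ?h u \<noteq> ?h' u"
      proof (rule ex1I[of _ u])
        show "u \<in> pverts G \<and> ?h u \<noteq> ?h' u" using u by simp
        show "x = u" if "x \<in> pverts G \<and> ?h x \<noteq> ?h' x" for x
        proof -
          have "h x \<noteq> h' x" "x \<in> pverts G" using that by auto
          then have "u = v" "x = v" using v[of x] v[of u] u by blast+
          then show ?thesis by simp
        qed
      qed
      then have "(?h, ?h') \<in> parcs ?R"
        using col[OF h(1)] col[OF h(2)] by (simp add: reconfiguration_graph_def)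
      then show ?thesis by (rule R.reachable_adj_trans[OF step.IH])
    qed
  qed
qed

lemma p5_diamond_free_arcs:
  assumes "pair_graph G" and free: "induced_free {path5, diamond} G"
  shows "p5_diamond_free (\<lambda>u v. (u, v) \<in> parcs G)"
proof -
  interpret pair_graph G by (fact assms)
  let ?E = "\<lambda>u v. (u, v) \<in> parcs G"
  have pg: "pair_graph F" if "F \<in> {path5, diamond}" for F
    using that pair_graph_path5 pair_graph_diamond by auto
  have "induced_free {path5, diamond} G \<longleftrightarrow> \<not> (\<exists>F\<in>{path5, diamond}. \<exists>h. inj_on h (pverts F) \<and>
      h ` pverts F \<subseteq> pverts G \<and>
      (\<forall>u\<in>pverts F. \<forall>v\<in>pverts F. (h u, h v) \<in> parcs G \<longleftrightarrow> (u, v) \<in> parcs F))"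
    by (intro induced_free_iff assms(1) pg)
  from iffD1[OF this free] have no_copy: False
    if "F \<in> {path5, diamond}" "inj_on h (pverts F)" "h ` pverts F \<subseteq> pverts G"
      "\<forall>u\<in>pverts F. \<forall>v\<in>pverts F. (h u, h v) \<in> parcs G \<longleftrightarrow> (u, v) \<in> parcs F" for F h
  proof (rule notE)
    show "\<exists>F\<in>{path5, diamond}. \<exists>h. inj_on h (pverts F) \<and> h ` pverts F \<subseteq> pverts G \<and>
      (\<forall>u\<in>pverts F. \<forall>v\<in>pverts F. (h u, h v) \<in> parcs G \<longleftrightarrow> (u, v) \<in> parcs F)"
      by (rule bexI, rule exI, intro conjI, rule that(2), rule that(3), rule that(4), rule that(1))
  qed
  have sym: "(v, u) \<in> parcs G" if "(u, v) \<in> parcs G" for u v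
    using that arcs_symmetric by blast
  have irr: "(u, u) \<notin> parcs G" for u using pair_no_loops[of "(u, u)"] by auto
  have V: "u \<in> pverts G \<and> v \<in> pverts G" if "(u, v) \<in> parcs G" for u v
    using that in_arcsD1 in_arcsD2 by blast
  have below5: "{..<5} = {0, 1, 2, 3, 4::nat}" and below4: "{..<4} = {0, 1, 2, 3::nat}" by auto
  show ?thesis
  proof unfold_locales
    fix a b c d e
    assume E: "?E a b" "?E b c" "?E c d" "?E d e"
    show "?E a c \<or> ?E a d \<or> ?E a e \<or> ?E b d \<or> ?E b e \<or> ?E c e"
    proof (rule ccontr)
      assume "\<not> ?thesis"
      then have N: "\<not> ?E a c" "\<not> ?E a d" "\<not> ?E a e" "\<not> ?E b d" "\<not> ?E b e" "\<not> ?E c e" by auto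
      have N': "\<not> ?E y x" if "\<not> ?E x y" for x y using that sym by blast
      let ?l = "[a, b, c, d, e]"
      have "distinct ?l" using E N sym irr by auto
      then have "inj_on ((!) ?l) (pverts path5)"
        by (intro inj_onI) (simp add: path5_def nth_eq_iff_index_eq)
      moreover have "(!) ?l ` pverts path5 \<subseteq> pverts G"
        using V[OF E(1)] V[OF E(2)] V[OF E(3)] V[OF E(4)] by (auto simp: path5_def below5)
      moreover have "\<forall>u\<in>pverts path5. \<forall>v\<in>pverts path5.
          (?l ! u, ?l ! v) \<in> parcs G \<longleftrightarrow> (u, v) \<in> parcs path5"
        by (simp add: path5_def below5 E E[THEN sym] N N[THEN N'] irr)
      ultimately show False using no_copy[of path5 "(!) ?l"] by simp
    qed
  next
    fix u v x y
    assume E: "?E u v" "?E u x" "?E v x" "?E u y" "?E v y"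
    show "x = y \<or> ?E x y"
    proof (rule ccontr)
      assume "\<not> ?thesis"
      then have N: "x \<noteq> y" "\<not> ?E x y" "\<not> ?E y x" using sym by auto
      \<comment> \<open>The missing edge of \<open>diamond\<close> joins 0 and 1, so the nonadjacent
        vertices come first.\<close>
      let ?l = "[x, y, u, v]"
      have "distinct ?l" using E N irr by auto
      then have "inj_on ((!) ?l) (pverts diamond)"
        by (intro inj_onI) (simp add: diamond_def nth_eq_iff_index_eq)
      moreover have "(!) ?l ` pverts diamond \<subseteq> pverts G"
        using V[OF E(2)] V[OF E(5)] by (auto simp: diamond_def below4)
      moreover have "\<forall>u\<in>pverts diamond. \<forall>v\<in>pverts diamond.
          (?l ! u, ?l ! v) \<in> parcs G \<longleftrightarrow> (u, v) \<in> parcs diamond"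
        by (simp add: diamond_def below4 E E[THEN sym] N irr)
      ultimately show False using no_copy[of diamond "(!) ?l"] by simp
    qed
  qed (use sym irr in auto)
qed

theorem theorem4:
  fixes G :: "'a pair_pre_digraph"
  assumes "pair_graph G"
    and "induced_free {path5, diamond} G"
  shows "recolorable G"
  unfolding recolorable_def
proof (intro allI impI)
  fix l assume "chromatic_number G + 1 \<le> l"
  \<comment> \<open>Any excess over the chromatic number goes into \<open>k\<close>, since a
    coloring with fewer colors is also a \<open>k\<close>-coloring.\<close>
  then obtain k where l: "l = Suc k" and k: "chromatic_number G \<le> k" by (cases l) auto
  interpret G: pair_graph G by (fact assms)
  let ?E = "\<lambda>u v. (u, v) \<in> parcs G" and ?R = "reconfiguration_graph G l"
  interpret R: pair_graph ?R by (rule pair_graph_reconfiguration_graph[OF assms(1)])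
  interpret p5_diamond_free ?E by (rule p5_diamond_free_arcs[OF assms])
  obtain c where c: "c \<in> colorings G (chromatic_number G)"
    using chromatic_number_attained[OF assms(1)] by blast
  have c_proper: "proper_coloring ?E (pverts G) {1..k} c" "c \<in> colorings G l"
    using c k l by (fastforce simp: proper_coloring_def colorings_def PiE_iff)+
  have mix: "mixing ?E (pverts G) {1..l}"
    unfolding l using c_proper by (intro mixing_of_colorable) auto
  have "f \<rightarrow>\<^sup>*\<^bsub>with_proj ?R\<^esub> g" if "f \<in> pverts ?R" "g \<in> pverts ?R" for f g
  proof -
    have "proper_coloring ?E (pverts G) {1..l} h \<and> restrict h (pverts G) = h" if "h \<in> pverts ?R" for h
      using that by (auto simp: reconfiguration_graph_def colorings_def proper_coloring_def PiE_restrict)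
    with that show ?thesis
      using rtranclp_recol_step_imp_reachable[OF assms(1) mixingD[OF mix]] by metis
  qed
  moreover have "pverts ?R \<noteq> {}" using c_proper(2) by (auto simp: reconfiguration_graph_def)
  ultimately show "Digraph_Component.connected (with_proj ?R)"
    unfolding connected_def by (intro strongly_connectedI R.reachable_mk_symmetricI) simp_all
qed

end
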